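(* Let $X$ be a topological space, let $Y$ be a topological space whose diagonal $\Delta=\{(y,y):y\in Y\}$ is functionally closed in $Y\times Y$, let $\alpha\in[1,\omega_1)$ be an ordinal, and put $\beta=\alpha$ if $\alpha<\omega_0$ and $\beta=\alpha+1$ if $\alpha\ge\omega_0$. For a map $f:X\to Y$ consider the following conditions: (1) $f\in {\rm B}_\alpha^{\rm st}(X,Y)$; (2) there exist an increasing sequence $(X_n)_{n=1}^\infty$ of subsets of $X$ of functionally multiplicative classes $<\beta$ and a sequence $(f_n)_{n=1}^\infty$ of maps $f_n\in{\rm B}_{<\alpha}^{\rm st}(X,Y)$ such that $X=\bigcup_{n=1}^\infty X_n$ and $f_n|_{X_n}=f|_{X_n}$ for all $n\in\mathbb N$; (3) there exist a partition $(X_n:n\in\mathbb N)$ of $X$ by functionally ambiguous sets of the class $\beta$ and a sequence of continuous maps $f_n:X\to Y$ such that $f_n|_{X_n}=f|_{X_n}$ for all $n\in\mathbb N$. Then $(1)\Leftrightarrow(2)\Rightarrow(3)$. If, moreover, one of the following conditions holds: (a) $Y$ is adhesive for $X$, or (b) $Y$ is a path-connected $\sigma$-adhesive for $X$, then $(3)\Rightarrow(2)$.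
   Context: Here $\omega_0$ is the first infinite ordinal and $\omega_1$ the first uncountable ordinal. Stable convergence and stable Baire classes: a sequence $(f_n)_{n=1}^\infty$ of maps $f_n:X\to Y$ is stably convergent to $f:X\to Y$ on $X$ if for every $x\in X$ there exists $k\in\mathbb N$ such that $f_n(x)=f(x)$ for all $n\ge k$. For $A\subseteq Y^X$, $\overline{A}^{\,{\rm st}}$ denotes the collection of all stable limits of sequences of maps from $A$. Put ${\rm B}_0^{\rm st}(X,Y)={\rm C}(X,Y)$ (all continuous maps $X\to Y$), and for each ordinal $\alpha\in(0,\omega_1)$ put ${\rm B}_{<\alpha}^{\rm st}(X,Y)=\bigcup_{\gamma<\alpha}{\rm B}_\gamma^{\rm st}(X,Y)$ and ${\rm B}_\alpha^{\rm st}(X,Y)=\overline{{\rm B}_{<\alpha}^{\rm st}(X,Y)}^{\,{\rm st}}$. Functional Borel classes: a set $A\subseteq X$ is functionally closed if $A=f^{-1}(0)$ for some continuous $f:X\to[0,1]$; it is functionally open if its complement is functionally closed. $\mathcal M_0(X)$ is the family of all functionally closed subsets of $X$, $\mathcal A_0(X)$ the family of all functionally open subsets. For $\alpha\in[1,\omega_1)$, $\mathcal M_\alpha(X)$ consists of all sets $\bigcap_{n=1}^\infty A_n$ with $A_n\in\bigcup_{\gamma<\alpha}\mathcal A_\gamma(X)$, and $\mathcal A_\alpha(X)$ consists of all sets $\bigcup_{n=1}^\infty A_n$ with $A_n\in\bigcup_{\gamma<\alpha}\mathcal M_\gamma(X)$. Elements of $\mathcal M_\alpha(X)$ are the sets of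 the $\alpha$'th functionally multiplicative class; a set is functionally ambiguous of the $\alpha$'th class if it belongs to $\mathcal M_\alpha(X)\cap\mathcal A_\alpha(X)$. A set is of functionally multiplicative class $<\beta$ if it belongs to $\mathcal M_\gamma(X)$ for some $\gamma<\beta$. A partition $(X_n:n\in\mathbb N)$ of $X$ means a family of pairwise disjoint sets with union $X$ (members may be empty). Adhesives: $Y$ is an adhesive for $X$ (adhesive for $X$) if for any two disjoint functionally closed sets $A$ and $B$ in $X$ and any continuous maps $f,g:X\to Y$ there exists a continuous map $h:X\to Y$ with $h|_A=f|_A$ and $h|_B=g|_B$. For a subspace $E\subseteq Y$, the pair $(Y,E)$ is a $*$-adhesive for $X$, written $(Y,E)\in{\rm Ad}^*(X)$, if there exists a point $y^*\in E$ such that for any continuous map $f:X\to Y$ and any two disjoint functionally closed sets $A$ and $B$ in $X$ with $f(A)\subseteq E$ there exists a continuous map $h:X\to Y$ such that $h|_A=f|_A$ and $h(x)=y^*$ for all $x\in B$. $Y$ is a $\sigma$-adhesive for $X$ if there exists a cover $(Y_n:n\in\mathbb N)$ of $Y$ by functionally closed subspaces $Y_n$ such that $(Y,Y_n)\in{\rm Ad}^*(X)$ for every $n$. *)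

theory Defs
  imports "HOL-Analysis.Analysis" "HOL-Library.Countable_Set_Type"
begin

text \<open>
  The type of countable ordinals. The library has no type of ordinals, but \<^term>\<open>cardSuc natLeq\<close>
  is the initial well-order of cardinality aleph-one; its field, ordered by it, is thus a
  well-order of type $\omega_1$, and \<open>a\<close> below stands for the order type of \<open>{..<a}\<close>.
\<close>

typedef countable_ordinal = "Field (cardSuc natLeq)"
proof -
  have "infinite (Field (cardSuc natLeq))"
    using cardSuc_finite[OF natLeq_Card_order] infinite_UNIV_nat Field_natLeq by simp
  then show ?thesis
    by (metis ex_in_conv finite.emptyI)
qed

lemma cardSuc_natLeq_Well_order: "Well_order (cardSuc natLeq)"
  using cardSuc_Card_order[OF natLeq_Card_order] card_order_on_well_order_on by blast

instantiation countable_ordinal :: wellorder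
begin

definition less_eq_countable_ordinal :: "countable_ordinal \<Rightarrow> countable_ordinal \<Rightarrow> bool" where
  "a \<le> b \<longleftrightarrow> (Rep_countable_ordinal a, Rep_countable_ordinal b) \<in> cardSuc natLeq"

definition less_countable_ordinal :: "countable_ordinal \<Rightarrow> countable_ordinal \<Rightarrow> bool" where
  "(a :: countable_ordinal) < b \<longleftrightarrow> a \<le> b \<and> a \<noteq> b"

instance
proof -
  let ?r = "cardSuc natLeq"
  have lin: "linear_order_on (Field ?r) ?r" and wf: "wf (?r - Id)"
    using cardSuc_natLeq_Well_order unfolding well_order_on_def by auto
  have refl: "refl_on (Field ?r) ?r" and trans: "trans ?r" and antisym: "antisym ?r"
    and total: "total_on (Field ?r) ?r"
    using lin unfolding linear_order_on_def partial_order_on_def preorder_on_def by auto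
  have mem: "Rep_countable_ordinal a \<in> Field ?r" for a
    by (rule Rep_countable_ordinal)
  have le_refl: "a \<le> a" for a :: countable_ordinal
    using refl mem unfolding less_eq_countable_ordinal_def refl_on_def by blast
  have le_trans: "a \<le> c" if "a \<le> b" "b \<le> c" for a b c :: countable_ordinal
    using that trans unfolding less_eq_countable_ordinal_def trans_def by blast
  have le_antisym: "a = b" if "a \<le> b" "b \<le> a" for a b :: countable_ordinal
    using that antisym unfolding less_eq_countable_ordinal_def antisym_def
    by (metis Rep_countable_ordinal_inject)
  have le_total: "a \<le> b \<or> b \<le> a" for a b :: countable_ordinal
    using total mem[of a] mem[of b] le_refl[of a]
    unfolding less_eq_countable_ordinal_def total_on_def by metis
  have wfless: "wf {(a, b :: countable_ordinal). a < b}"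
  proof (rule wf_subset[OF wf_inv_image[OF wf, of Rep_countable_ordinal]])
    show "{(a, b :: countable_ordinal). a < b} \<subseteq> inv_image (?r - Id) Rep_countable_ordinal"
      unfolding less_countable_ordinal_def less_eq_countable_ordinal_def inv_image_def
      by (auto simp: Rep_countable_ordinal_inject)
  qed
  show "OFCLASS(countable_ordinal, wellorder_class)"
  proof (standard, goal_cases)
    case (1 x y) then show ?case
      using le_antisym le_refl unfolding less_countable_ordinal_def by blast
  next
    case (2 x) then show ?case by (rule le_refl)
  next
    case (3 x y z) then show ?case by (rule le_trans)
  next
    case (4 x y) then show ?case by (rule le_antisym)
  next
    case (5 x y) then show ?case by (rule le_total)
  next
    case (6 P a) then show ?case
      using wf_induct_rule[OF wfless, of P a] by blast
  qed
qed

end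

lemma wf_countable_ordinal_less: "wf {(a, b :: countable_ordinal). a < b}"
  by (rule wf)

lemma countable_lessThan_countable_ordinal: "countable {..<a :: countable_ordinal}"
proof -
  include cardinal_syntax
  let ?r = "cardSuc natLeq"
  let ?u = "underS ?r (Rep_countable_ordinal a)"
  have "|?u| <o ?r"
    by (rule card_of_underS[OF cardSuc_Card_order[OF natLeq_Card_order] Rep_countable_ordinal])
  then have "|?u| \<le>o natLeq"
    using cardSuc_ordLeq_ordLess[OF natLeq_Card_order card_of_Card_order] by blast
  then have "countable ?u"
    by (simp add: countable_card_le_natLeq)
  moreover have "Rep_countable_ordinal ` {..<a} \<subseteq> ?u"
    by (auto simp: underS_def less_countable_ordinal_def less_eq_countable_ordinal_def
        Rep_countable_ordinal_inject)
  ultimately have "countable (Rep_countable_ordinal ` {..<a})"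
    by (rule countable_subset[rotated])
  then show ?thesis
    by (rule countable_image_inj_on) (simp add: inj_on_def Rep_countable_ordinal_inject)
qed

lemma uncountable_UNIV_countable_ordinal: "uncountable (UNIV :: countable_ordinal set)"
proof
  include cardinal_syntax
  assume "countable (UNIV :: countable_ordinal set)"
  then have "countable (range Rep_countable_ordinal)" by simp
  then have c: "countable (Field (cardSuc natLeq))"
    using type_definition.Rep_range[OF type_definition_countable_ordinal] by simp
  have "|Field (cardSuc natLeq)| \<le>o natLeq"
    using c by (simp add: countable_card_le_natLeq)
  then have "cardSuc natLeq \<le>o natLeq"
    using card_of_Field_ordIso[OF cardSuc_Card_order[OF natLeq_Card_order]]
      ordIso_ordLeq_trans ordIso_symmetric by blast
  then show False
    using cardSuc_greater[OF natLeq_Card_order] not_ordLess_ordLeq by blast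
qed

lemma countable_ordinal_bounded:
  assumes "countable (A :: countable_ordinal set)"
  shows "\<exists>b. \<forall>a\<in>A. a < b"
proof (rule ccontr)
  assume "\<not> ?thesis"
  then have "UNIV = (\<Union>a\<in>A. {..<a} \<union> {a})"
    by (auto simp: not_less le_less)
  moreover have "countable (\<Union>a\<in>A. {..<a} \<union> {a})"
    using assms countable_lessThan_countable_ordinal by (intro countable_UN) auto
  ultimately show False
    using uncountable_UNIV_countable_ordinal by simp
qed

definition ord_succ :: "countable_ordinal \<Rightarrow> countable_ordinal" where
  "ord_succ a = (LEAST b. a < b)"

definition ord_omega0 :: countable_ordinal where
  "ord_omega0 = (LEAST a. infinite {..<a})"

instantiation countable_ordinal :: "{zero, one}"
begin

definition zero_countable_ordinal :: countable_ordinal where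
  "(0 :: countable_ordinal) = (LEAST a. True)"

definition one_countable_ordinal :: countable_ordinal where
  "(1 :: countable_ordinal) = ord_succ 0"

instance ..

end

lemma countable_ordinal_zero_le [simp]: "0 \<le> (a :: countable_ordinal)"
  unfolding zero_countable_ordinal_def by (rule Least_le) simp

lemma less_ord_succ: "a < ord_succ a"
  unfolding ord_succ_def using countable_ordinal_bounded[of "{a}"] by (auto intro: LeastI_ex)

lemma ord_succ_le_iff: "ord_succ a \<le> b \<longleftrightarrow> a < b"
  using less_ord_succ[of a] unfolding ord_succ_def
  by (auto intro: Least_le)

lemma one_le_countable_ordinal_iff: "1 \<le> a \<longleftrightarrow> (0 :: countable_ordinal) < a"
  unfolding one_countable_ordinal_def by (rule ord_succ_le_iff)

lemma infinite_lessThan_ord_omega0: "infinite {..<ord_omega0}"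
proof -
  obtain S :: "countable_ordinal set" where S: "infinite S" "countable S"
    using infinite_countable_subset'[of "UNIV :: countable_ordinal set"]
      uncountable_infinite[OF uncountable_UNIV_countable_ordinal] by blast
  obtain b where "\<forall>a\<in>S. a < b"
    using countable_ordinal_bounded[OF S(2)] by blast
  then have "infinite {..<b}"
    using S(1) finite_subset[of S "{..<b}"] by auto
  then show ?thesis
    unfolding ord_omega0_def by (rule LeastI)
qed

lemma less_ord_omega0_iff: "a < ord_omega0 \<longleftrightarrow> finite {..<a}"
proof
  show "finite {..<a}" if "a < ord_omega0"
    using not_less_Least[of a "\<lambda>a. infinite {..<a}"] that unfolding ord_omega0_def by blast
  show "a < ord_omega0" if "finite {..<a}"
    using that infinite_lessThan_ord_omega0 finite_subset[of "{..<ord_omega0}" "{..<a}"]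
    by (metis lessThan_subset_iff not_le)
qed

definition stably_convergent :: "(nat \<Rightarrow> 'a \<Rightarrow> 'b) \<Rightarrow> ('a \<Rightarrow> 'b) \<Rightarrow> bool" where
  "stably_convergent F f \<longleftrightarrow> (\<forall>x. \<exists>k. \<forall>n\<ge>k. F n x = f x)"

definition stable_closure :: "('a \<Rightarrow> 'b) set \<Rightarrow> ('a \<Rightarrow> 'b) set" where
  "stable_closure A = {f. \<exists>F. (\<forall>n. F n \<in> A) \<and> stably_convergent F f}"

function stable_baire :: "countable_ordinal \<Rightarrow> ('a::topological_space \<Rightarrow> 'b::topological_space) set" where
  "stable_baire \<alpha> =
     (if \<alpha> = 0 then {f. continuous_on UNIV f} else stable_closure (\<Union>\<gamma>\<in>{..<\<alpha>}. stable_baire \<gamma>))"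
  by auto
termination
  by (relation "{(a, b). a < b}") (auto intro: wf_countable_ordinal_less)

declare stable_baire.simps [simp del]

definition stable_baire_less :: "countable_ordinal \<Rightarrow> ('a::topological_space \<Rightarrow> 'b::topological_space) set" where
  "stable_baire_less \<alpha> = (\<Union>\<gamma>\<in>{..<\<alpha>}. stable_baire \<gamma>)"

lemma stable_baire_0: "stable_baire 0 = {f. continuous_on UNIV f}"
  by (simp add: stable_baire.simps)

lemma stable_baire_pos: "0 < \<alpha> \<Longrightarrow> stable_baire \<alpha> = stable_closure (stable_baire_less \<alpha>)"
  by (subst stable_baire.simps) (auto simp: stable_baire_less_def)

definition functionally_closed :: "'a::topological_space set \<Rightarrow> bool" where
  "functionally_closed A \<longleftrightarrow>
     (\<exists>f :: 'a \<Rightarrow> real. continuous_on UNIV f \<and> range f \<subseteq> {0..1} \<and> A = f -` {0})"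

definition functionally_open :: "'a::topological_space set \<Rightarrow> bool" where
  "functionally_open A \<longleftrightarrow> functionally_closed (- A)"

text \<open>
  \<open>fun_mult\<close> and \<open>fun_add\<close> are the functionally multiplicative and additive classes.
\<close>

function
  fun_mult :: "countable_ordinal \<Rightarrow> 'a::topological_space set set" and
  fun_add :: "countable_ordinal \<Rightarrow> 'a::topological_space set set" where
  "fun_mult \<alpha> =
     (if \<alpha> = 0 then {A. functionally_closed A}
      else {\<Inter>n. A n |A :: nat \<Rightarrow> 'a set. \<forall>n. A n \<in> (\<Union>\<gamma>\<in>{..<\<alpha>}. fun_add \<gamma>)})"
| "fun_add \<alpha> =
     (if \<alpha> = 0 then {A. functionally_open A}
      else {\<Union>n. A n |A :: nat \<Rightarrow> 'a set. \<forall>n. A n \<in> (\<Union>\<gamma>\<in>{..<\<alpha>}. fun_mult \<gamma>)})"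
  by pat_completeness auto
termination
  by (relation "inv_image {(a, b). a < b} (case_sum id id)")
    (auto intro: wf_countable_ordinal_less)

declare fun_mult.simps [simp del] fun_add.simps [simp del]

definition fun_mult_less :: "countable_ordinal \<Rightarrow> 'a::topological_space set set" where
  "fun_mult_less \<beta> = (\<Union>\<gamma>\<in>{..<\<beta>}. fun_mult \<gamma>)"

definition fun_ambiguous :: "countable_ordinal \<Rightarrow> 'a::topological_space set set" where
  "fun_ambiguous \<alpha> = fun_mult \<alpha> \<inter> fun_add \<alpha>"

text \<open>
  Spaces are types here, so \<open>X\<close> and \<open>Y\<close> enter through arguments of type \<open>itself\<close>. In
  \<open>star_adhesive_for E X\<close>, the space \<open>Y\<close> of the pair \<open>(Y, E)\<close> is the type of the elements of \<open>E\<close>.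
\<close>

definition adhesive_for :: "'b::topological_space itself \<Rightarrow> 'a::topological_space itself \<Rightarrow> bool" where
  "adhesive_for Y X \<longleftrightarrow>
     (\<forall>(A :: 'a set) B (f :: 'a \<Rightarrow> 'b) g.
        functionally_closed A \<and> functionally_closed B \<and> A \<inter> B = {} \<and>
        continuous_on UNIV f \<and> continuous_on UNIV g \<longrightarrow>
        (\<exists>h. continuous_on UNIV h \<and> (\<forall>x\<in>A. h x = f x) \<and> (\<forall>x\<in>B. h x = g x)))"

definition star_adhesive_for :: "'b::topological_space set \<Rightarrow> 'a::topological_space itself \<Rightarrow> bool" where
  "star_adhesive_for E X \<longleftrightarrow>
     (\<exists>y\<in>E. \<forall>(f :: 'a \<Rightarrow> 'b) A B.
        continuous_on UNIV f \<and> functionally_closed A \<and> functionally_closed B \<and> A \<inter> B = {} \<and>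
        f ` A \<subseteq> E \<longrightarrow>
        (\<exists>h. continuous_on UNIV h \<and> (\<forall>x\<in>A. h x = f x) \<and> (\<forall>x\<in>B. h x = y)))"

definition sigma_adhesive_for :: "'b::topological_space itself \<Rightarrow> 'a::topological_space itself \<Rightarrow> bool" where
  "sigma_adhesive_for Y X \<longleftrightarrow>
     (\<exists>E :: nat \<Rightarrow> 'b set. (\<Union>n. E n) = UNIV \<and>
        (\<forall>n. functionally_closed (E n) \<and> star_adhesive_for (E n) X))"

definition stably_exhausted ::
  "countable_ordinal \<Rightarrow> countable_ordinal \<Rightarrow> ('a::topological_space \<Rightarrow> 'b::topological_space) \<Rightarrow> bool" where
  "stably_exhausted \<alpha> \<beta> f \<longleftrightarrow>
     (\<exists>(X :: nat \<Rightarrow> 'a set) (F :: nat \<Rightarrow> 'a \<Rightarrow> 'b).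
        incseq X \<and> (\<forall>n. X n \<in> fun_mult_less \<beta>) \<and>
        (\<forall>n. F n \<in> stable_baire_less \<alpha>) \<and>
        (\<Union>n. X n) = UNIV \<and> (\<forall>n. \<forall>x\<in>X n. F n x = f x))"

definition piecewise_continuous_on_ambiguous ::
  "countable_ordinal \<Rightarrow> ('a::topological_space \<Rightarrow> 'b::topological_space) \<Rightarrow> bool" where
  "piecewise_continuous_on_ambiguous \<beta> f \<longleftrightarrow>
     (\<exists>(X :: nat \<Rightarrow> 'a set) (F :: nat \<Rightarrow> 'a \<Rightarrow> 'b).
        disjoint_family X \<and> (\<Union>n. X n) = UNIV \<and> (\<forall>n. X n \<in> fun_ambiguous \<beta>) \<and>
        (\<forall>n. continuous_on UNIV (F n)) \<and> (\<forall>n. \<forall>x\<in>X n. F n x = f x))"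

end

theory Submission
  imports Defs
begin

text \<open>
  Write $\alpha'$ for $\alpha$ if $\alpha < \omega_0$ and for $\alpha + 1$ otherwise. If two maps are
  piecewise continuous on ambiguous sets of class $\gamma'$, then they agree on a set of multiplicative
  class $\gamma'$, because the diagonal is functionally closed. Given a stable limit of maps $f_n$, the sets
  $X_n = \{x : f_m(x) = f_n(x) \mbox{ for all } m \ge n\}$ therefore have multiplicative classes
  $< \alpha'$, and (1), (2), (3) follow from one another by induction on $\alpha$.

  Conversely, let $f$ agree with the continuous map $g_m$ on $P_m$, where the sets $P_m$ cover the space
  and are of multiplicative classes $< \alpha'$. For $\alpha > 1$ each $P_m$ is an
  intersection of sets $B_{m,j}$, each ambiguous of class $\kappa'$ for some $1 \le \kappa < \alpha$. Let
  $h_n(x) = g_m(x)$ for the least $m \le n$ with $x \in \bigcap_{j \le n} B_{m,j}$, and $m = n + 1$ if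
  there is none. By induction $h_n$ is of
  class $< \alpha$, and $h_n$ converges stably to $f$ because finitely many $B_{m,j}$ exclude every
  $m$ below the first one with $x \in P_m$. Adhesives enter only for $\alpha = 1$, where
  continuous maps on finitely many disjoint functionally closed sets have to be glued.
\<close>

section \<open>Countable ordinals and the shift from \<open>\<alpha>\<close> to
  \<open>\<beta>\<close>\<close>

definition class_shift :: "countable_ordinal \<Rightarrow> countable_ordinal" where
  "class_shift a = (if a < ord_omega0 then a else ord_succ a)"

lemma ord_succ_less_omega0: "a < ord_omega0 \<Longrightarrow> ord_succ a < ord_omega0"
proof -
  assume "a < ord_omega0"
  moreover have "{..<ord_succ a} \<subseteq> insert a {..<a}"
    using ord_succ_le_iff[of a] by (metis insertI1 insertI2 lessThan_iff linorder_neqE not_less subsetI)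
  ultimately show ?thesis
    unfolding less_ord_omega0_iff using finite_subset by blast
qed

lemma zero_less_omega0: "0 < ord_omega0"
proof -
  have "{..<0::countable_ordinal} = {}"
    using countable_ordinal_zero_le leD by blast
  then show ?thesis
    by (simp add: less_ord_omega0_iff)
qed

lemma one_less_omega0: "1 < ord_omega0"
  unfolding one_countable_ordinal_def by (rule ord_succ_less_omega0[OF zero_less_omega0])

lemma class_shift_0 [simp]: "class_shift 0 = 0"
  by (simp add: class_shift_def zero_less_omega0)

lemma class_shift_1 [simp]: "class_shift 1 = 1"
  by (simp add: class_shift_def one_less_omega0)

lemma le_class_shift: "a \<le> class_shift a"
  using less_ord_succ[of a] by (auto simp: class_shift_def intro: less_imp_le)

text \<open>A strict inequality leaves room for one successor, so everything shifted from below
  \<open>b\<close> stays within \<open>b\<close> itself.\<close>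

lemma class_shift_le: "a < b \<Longrightarrow> class_shift a \<le> b"
  using ord_succ_le_iff[of a b] by (auto simp: class_shift_def intro: less_imp_le)

lemma class_shift_mono: "a \<le> b \<Longrightarrow> class_shift a \<le> class_shift b"
  by (metis class_shift_le le_class_shift le_less order_trans)

section \<open>Functionally closed sets\<close>

text \<open>Truncating the absolute value at 1 keeps the zero set, so any continuous real function
  may serve as a witness.\<close>

lemma functionally_closed_iff:
  "functionally_closed A \<longleftrightarrow> (\<exists>u :: 'a::topological_space \<Rightarrow> real. continuous_on UNIV u \<and> A = {x. u x = 0})"
proof
  assume "\<exists>u :: 'a \<Rightarrow> real. continuous_on UNIV u \<and> A = {x. u x = 0}"
  then obtain u :: "'a \<Rightarrow> real" where u: "continuous_on UNIV u" "A = {x. u x = 0}" by blast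
  have "continuous_on UNIV (\<lambda>x. min 1 \<bar>u x\<bar>)" by (intro continuous_intros u)
  moreover have "range (\<lambda>x. min 1 \<bar>u x\<bar>) \<subseteq> {0..1}" by auto
  moreover have "A = (\<lambda>x. min 1 \<bar>u x\<bar>) -` {0}" using u by (auto simp: min_def split: if_splits)
  ultimately show "functionally_closed A" unfolding functionally_closed_def by blast
qed (auto simp: functionally_closed_def vimage_def)

lemma functionally_closed_zeros:
  "continuous_on UNIV u \<Longrightarrow> functionally_closed {x. u x = (0::real)}"
  unfolding functionally_closed_iff by blast

lemma functionally_closed_le:
  assumes "continuous_on UNIV (u :: _ \<Rightarrow> real)" "continuous_on UNIV v"
  shows "functionally_closed {x. u x \<le> v x}"
proof -
  have "{x. u x \<le> v x} = {x. max 0 (u x - v x) = 0}" by auto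
  then show ?thesis
    by (simp only:) (intro functionally_closed_zeros continuous_intros assms)
qed

lemma functionally_closed_empty: "functionally_closed {}"
  using functionally_closed_zeros[of "\<lambda>_. 1"] by simp

lemma functionally_closed_UNIV: "functionally_closed UNIV"
  using functionally_closed_zeros[of "\<lambda>_. 0"] by simp

lemma functionally_closed_Un:
  assumes "functionally_closed A" "functionally_closed B"
  shows "functionally_closed (A \<union> B)"
proof -
  obtain u v :: "_ \<Rightarrow> real" where u: "continuous_on UNIV u" "A = {x. u x = 0}"
    and v: "continuous_on UNIV v" "B = {x. v x = 0}"
    using assms unfolding functionally_closed_iff by blast
  have "A \<union> B = {x. u x * v x = 0}" using u v by auto
  then show ?thesis
    by (simp only:) (intro functionally_closed_zeros continuous_intros u v)
qed

lemma functionally_closed_UN: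
  assumes "finite I" "\<And>i. i \<in> I \<Longrightarrow> functionally_closed (A i)"
  shows "functionally_closed (\<Union>i\<in>I. A i)"
  using assms by induction (auto intro: functionally_closed_empty functionally_closed_Un)

text \<open>The weights \<open>(1/2)^n\<close> make the series of witnesses with values in [0,1]
  converge uniformly, and a sum of nonnegative terms vanishes exactly where all its terms
  do.\<close>

lemma functionally_closed_INT:
  fixes A :: "nat \<Rightarrow> 'a::topological_space set"
  assumes "\<And>n. functionally_closed (A n)"
  shows "functionally_closed (\<Inter>n. A n)"
proof -
  have "\<forall>n. \<exists>u :: 'a \<Rightarrow> real. continuous_on UNIV u \<and> range u \<subseteq> {0..1} \<and> A n = u -` {0}"
    using assms unfolding functionally_closed_def by blast
  then obtain u :: "nat \<Rightarrow> 'a \<Rightarrow> real"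
    where u: "\<And>n. continuous_on UNIV (u n)" "\<And>n. range (u n) \<subseteq> {0..1}" "\<And>n. A n = u n -` {0}"
    by metis
  have u01: "0 \<le> u n x" "u n x \<le> 1" for n x using u(2)[of n] by (auto simp: image_subset_iff)
  have bound: "norm ((1/2)^n * u n x) \<le> (1/2)^n" for n x
    using u01[of n x] by (simp add: abs_mult mult_left_le)
  have sm: "summable (\<lambda>n. (1/2)^n * u n x)" for x
    by (rule summable_comparison_test'[OF summable_geometric[of "1/2::real"] bound]) simp
  have "uniform_limit UNIV (\<lambda>n x. \<Sum>i<n. (1/2)^i * u i x) (\<lambda>x. \<Sum>n. (1/2)^n * u n x) sequentially"
    by (rule Weierstrass_m_test[OF bound summable_geometric]) simp
  then have "continuous_on UNIV (\<lambda>x. \<Sum>n. (1/2)^n * u n x)"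
    by (rule uniform_limit_theorem[rotated])
      (auto intro!: always_eventually continuous_intros u(1))
  moreover have "(\<Inter>n. A n) = {x. (\<Sum>n. (1/2)^n * u n x) = 0}"
    using suminf_eq_zero_iff[OF sm] u01 by (auto simp: u(3))
  ultimately show ?thesis by (simp only: functionally_closed_zeros)
qed

lemma functionally_closed_vimage:
  assumes "functionally_closed B" "continuous_on UNIV g"
  shows "functionally_closed (g -` B)"
proof -
  obtain u where u: "continuous_on UNIV (u :: _ \<Rightarrow> real)" "B = {x. u x = 0}"
    using assms unfolding functionally_closed_iff by blast
  have "g -` B = {x. (u \<circ> g) x = 0}" using u by auto
  then show ?thesis
    using continuous_on_compose[OF assms(2)] u(1) continuous_on_subset
    by (metis functionally_closed_zeros subset_UNIV)
qed

text \<open>This set is the preimage of the diagonal under the continuous map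
  \<open>(g x, h x)\<close>; the hypothesis on the diagonal enters the proof here.\<close>

lemma functionally_closed_eq:
  fixes g h :: "'a::topological_space \<Rightarrow> 'b::topological_space"
  assumes "functionally_closed {(y, y) | y :: 'b. True}"
    and "continuous_on UNIV g" "continuous_on UNIV h"
  shows "functionally_closed {x. g x = h x}"
proof -
  have "{x. g x = h x} = (\<lambda>x. (g x, h x)) -` {(y, y) | y :: 'b. True}" by auto
  then show ?thesis
    by (simp only:) (intro functionally_closed_vimage continuous_intros assms)
qed

text \<open>The quotient \<open>f / (f + g)\<close> of the witnesses works: both are nonnegative and
  have disjoint zero sets, so the denominator never vanishes.\<close>

lemma functionally_closed_separate:
  fixes A B :: "'a::topological_space set"
  assumes "functionally_closed A" "functionally_closed B" "A \<inter> B = {}"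
  obtains u :: "'a \<Rightarrow> real" where "continuous_on UNIV u" "range u \<subseteq> {0..1}"
    "\<forall>x\<in>A. u x = 0" "\<forall>x\<in>B. u x = 1"
proof -
  obtain f g :: "'a \<Rightarrow> real" where f: "continuous_on UNIV f" "range f \<subseteq> {0..1}" "A = f -` {0}"
    and g: "continuous_on UNIV g" "range g \<subseteq> {0..1}" "B = g -` {0}"
    using assms(1,2) unfolding functionally_closed_def by blast
  have nn: "0 \<le> f x" "0 \<le> g x" for x using f(2) g(2) by (auto simp: image_subset_iff)
  have ne: "f x + g x \<noteq> 0" for x
    using assms(3) nn[of x] f(3) g(3) by (auto simp: add_nonneg_eq_0_iff)
  show thesis
  proof
    show "continuous_on UNIV (\<lambda>x. f x / (f x + g x))"
      using ne by (intro continuous_intros f g) auto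
    show "range (\<lambda>x. f x / (f x + g x)) \<subseteq> {0..1}"
      using nn by (auto simp: divide_le_eq_1 intro!: divide_nonneg_nonneg add_nonneg_nonneg)
         (metis add_nonneg_nonneg less_eq_real_def ne)
    show "\<forall>x\<in>A. f x / (f x + g x) = 0" using f by auto
    show "\<forall>x\<in>B. f x / (f x + g x) = 1" using g ne by (metis add_0_right divide_self vimage_singleton_eq)
  qed
qed

section \<open>Functionally multiplicative and additive classes\<close>

lemma fun_mult_0: "A \<in> fun_mult 0 \<longleftrightarrow> functionally_closed A"
  by (simp add: fun_mult.simps)

lemma fun_add_0: "A \<in> fun_add 0 \<longleftrightarrow> functionally_open A"
  by (simp add: fun_add.simps)

lemma fun_mult_pos:
  fixes A :: "'a::topological_space set"
  shows "0 < \<alpha> \<Longrightarrow> A \<in> fun_mult \<alpha> \<longleftrightarrow> (\<exists>S. (\<forall>n::nat. \<exists>\<gamma><\<alpha>. S n \<in> fun_add \<gamma>) \<and> A = (\<Inter>n. S n))"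
proof -
  assume "0 < \<alpha>"
  then have "\<alpha> \<noteq> 0" by (rule less_imp_neq[symmetric])
  then have "fun_mult \<alpha> = {\<Inter>n. S n |S :: nat \<Rightarrow> 'a set. \<forall>n. S n \<in> (\<Union>\<gamma>\<in>{..<\<alpha>}. fun_add \<gamma>)}"
    by (subst fun_mult.simps) simp
  then show ?thesis
    unfolding UN_iff Bex_def lessThan_iff by (simp only: mem_Collect_eq conj_commute)
qed

lemma fun_add_pos:
  fixes A :: "'a::topological_space set"
  shows "0 < \<alpha> \<Longrightarrow> A \<in> fun_add \<alpha> \<longleftrightarrow> (\<exists>S. (\<forall>n::nat. \<exists>\<gamma><\<alpha>. S n \<in> fun_mult \<gamma>) \<and> A = (\<Union>n. S n))"
proof -
  assume "0 < \<alpha>"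
  then have "\<alpha> \<noteq> 0" by (rule less_imp_neq[symmetric])
  then have "fun_add \<alpha> = {\<Union>n. S n |S :: nat \<Rightarrow> 'a set. \<forall>n. S n \<in> (\<Union>\<gamma>\<in>{..<\<alpha>}. fun_mult \<gamma>)}"
    by (subst fun_add.simps) simp
  then show ?thesis
    unfolding UN_iff Bex_def lessThan_iff by (simp only: mem_Collect_eq conj_commute)
qed

text \<open>De Morgan's laws, carried through transfinite induction. Facts about one kind of class
  then transfer to the other.\<close>

lemma fun_compl:
  fixes A :: "'a::topological_space set"
  shows
  "A \<in> fun_mult \<alpha> \<longleftrightarrow> - A \<in> fun_add \<alpha>"
proof (induction \<alpha> arbitrary: A rule: less_induct)
  case (less \<alpha>)
  show ?case
  proof (cases "\<alpha> = 0")
    case True then show ?thesis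
      by (simp add: fun_mult_0 fun_add_0 functionally_open_def)
  next
    case False
    then have pos: "0 < \<alpha>" by (simp add: order.not_eq_order_implies_strict)
    have IH: "S \<in> fun_mult \<gamma> \<longleftrightarrow> - S \<in> fun_add \<gamma>" if "\<gamma> < \<alpha>"  for S :: "'a set" and \<gamma>
      using less that by blast
    have IH': "S \<in> fun_add \<gamma> \<longleftrightarrow> - S \<in> fun_mult \<gamma>" if "\<gamma> < \<alpha>"  for S :: "'a set" and \<gamma>
      using IH[OF that, of "- S"] by simp
    show ?thesis
      unfolding fun_mult_pos[OF pos] fun_add_pos[OF pos]
    proof
      assume "\<exists>S. (\<forall>n::nat. \<exists>\<gamma><\<alpha>. S n \<in> fun_add \<gamma>) \<and> A = (\<Inter>n. S n)"
      then obtain S where "\<forall>n::nat. \<exists>\<gamma><\<alpha>. S n \<in> fun_add \<gamma>" "A = (\<Inter>n. S n)" by blast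
      then have "\<forall>n. \<exists>\<gamma><\<alpha>. - S n \<in> fun_mult \<gamma>" "- A = (\<Union>n. - S n)" using IH' by (blast, simp)
      then show "\<exists>S. (\<forall>n::nat. \<exists>\<gamma><\<alpha>. S n \<in> fun_mult \<gamma>) \<and> - A = (\<Union>n. S n)"
        by (intro exI[of _ "\<lambda>n. - S n"]) blast
    next
      assume "\<exists>S. (\<forall>n::nat. \<exists>\<gamma><\<alpha>. S n \<in> fun_mult \<gamma>) \<and> - A = (\<Union>n. S n)"
      then obtain S where "\<forall>n::nat. \<exists>\<gamma><\<alpha>. S n \<in> fun_mult \<gamma>" "- A = (\<Union>n. S n)" by blast
      then have "\<forall>n. \<exists>\<gamma><\<alpha>. - S n \<in> fun_add \<gamma>" "A = (\<Inter>n. - S n)" using IH by (blast, auto)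
      then show "\<exists>S. (\<forall>n::nat. \<exists>\<gamma><\<alpha>. S n \<in> fun_add \<gamma>) \<and> A = (\<Inter>n. S n)"
        by (intro exI[of _ "\<lambda>n. - S n"]) blast
    qed
  qed
qed

lemma countable_ordinal_pos: "\<gamma> < \<delta> \<Longrightarrow> 0 < (\<delta> :: countable_ordinal)"
  by (rule le_less_trans[OF countable_ordinal_zero_le])

lemma fun_mult_imp_add:
  assumes "A \<in> fun_mult \<gamma>" "\<gamma> < \<delta>"
  shows "A \<in> fun_add \<delta>"
  unfolding fun_add_pos[OF countable_ordinal_pos[OF assms(2)]]
  using assms by (intro exI[of _ "\<lambda>_. A"]) auto

lemma fun_add_imp_mult:
  assumes "A \<in> fun_add \<gamma>" "\<gamma> < \<delta>"
  shows "A \<in> fun_mult \<delta>"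
  unfolding fun_mult_pos[OF countable_ordinal_pos[OF assms(2)]]
  using assms by (intro exI[of _ "\<lambda>_. A"]) auto

text \<open>Above class 0 the same sequence of sets remains admissible. The base case rests on
  writing a functionally closed set as a countable intersection of functionally open ones.\<close>

lemma fun_mult_mono:
  assumes "A \<in> fun_mult \<gamma>" "\<gamma> \<le> \<delta>"
  shows "A \<in> fun_mult \<delta>"
proof (cases "\<gamma> = \<delta>")
  case False
  then have less: "\<gamma> < \<delta>" using assms by simp
  then have pos: "0 < \<delta>" using le_less_trans[OF countable_ordinal_zero_le] by blast
  show ?thesis
  proof (cases "\<gamma> = 0")
    case True
    then have "functionally_closed A" using assms(1) by (simp add: fun_mult_0)
    then obtain u :: "_ \<Rightarrow> real" where u: "continuous_on UNIV u" "range u \<subseteq> {0..1}" "A = u -` {0}"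
      unfolding functionally_closed_def by blast
    \<comment> \<open>The zero set of the nonnegative \<open>u\<close> is the intersection of strict
      sublevel sets whose bounds tend to 0.\<close>
    let ?S = "\<lambda>n. {x. u x < 1 / real (Suc n)}"
    have "- ?S n = {x. 1 / real (Suc n) \<le> u x}" for n by auto
    then have "?S n \<in> fun_add 0" for n
      unfolding fun_add_0 functionally_open_def
      by (simp only:) (intro functionally_closed_le continuous_intros u)
    moreover have "A = (\<Inter>n. ?S n)"
    proof
      show "(\<Inter>n. ?S n) \<subseteq> A"
      proof
        fix x assume "x \<in> (\<Inter>n. ?S n)"
        then have "u x < 1 / real (Suc n)" for n by blast
        then have "\<not> 0 < u x" using nat_approx_posE[of "u x"] by (metis less_asym)
        moreover have "u x \<ge> 0" using u(2) by (auto simp: image_subset_iff)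
        ultimately show "x \<in> A" using u(3) by simp
      qed
    qed (use u in auto)
    ultimately have "(\<forall>n. \<exists>\<gamma><\<delta>. ?S n \<in> fun_add \<gamma>) \<and> A = (\<Inter>n. ?S n)"
      using pos by simp blast
    then show ?thesis
      unfolding fun_mult_pos[OF pos] by (rule exI[of _ ?S])
  next
    case False
    then have "0 < \<gamma>" by (simp add: order.not_eq_order_implies_strict)
    with assms(1) obtain S where S: "\<forall>n::nat. \<exists>\<beta><\<gamma>. S n \<in> fun_add \<beta>" "A = (\<Inter>n. S n)"
      using fun_mult_pos by blast
    have "\<exists>\<beta><\<delta>. S n \<in> fun_add \<beta>" for n
      using S(1) less less_trans by blast
    then show ?thesis
      unfolding fun_mult_pos[OF pos] using S(2) by (intro exI[of _ S]) simp
  qed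
qed (use assms in simp)

lemma fun_add_mono: "A \<in> fun_add \<gamma> \<Longrightarrow> \<gamma> \<le> \<delta> \<Longrightarrow> A \<in> fun_add \<delta>"
  using fun_mult_mono[of "- A"] by (simp add: fun_compl)

lemma fun_mult_INT:
  fixes A :: "nat \<Rightarrow> 'a::topological_space set"
  assumes "\<And>n. A n \<in> fun_mult \<alpha>"
  shows "(\<Inter>n. A n) \<in> fun_mult \<alpha>"
proof (cases "\<alpha> = 0")
  case True
  then show ?thesis using assms functionally_closed_INT[of A] by (simp add: fun_mult_0)
next
  case False
  then have pos: "0 < \<alpha>" by (simp add: order.not_eq_order_implies_strict)
  have "\<forall>n. \<exists>S. (\<forall>k::nat. \<exists>\<gamma><\<alpha>. S k \<in> fun_add \<gamma>) \<and> A n = (\<Inter>k. S k)"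
    using assms unfolding fun_mult_pos[OF pos] by blast
  from choice[OF this] obtain S
    where "\<forall>n. (\<forall>k::nat. \<exists>\<gamma><\<alpha>. S n k \<in> fun_add \<gamma>) \<and> A n = (\<Inter>k. S n k)" ..
  then have S: "\<exists>\<gamma><\<alpha>. S n k \<in> fun_add \<gamma>" "A n = (\<Inter>k. S n k)" for n k by simp_all
  \<comment> \<open>The double sequence of additive sets is enumerated as a single one.\<close>
  let ?T = "\<lambda>i. S (fst (prod_decode i)) (snd (prod_decode i))"
  have "(\<Inter>n. A n) = (\<Inter>i. ?T i)"
  proof (intro set_eqI iffI)
    fix x assume x: "x \<in> (\<Inter>i. ?T i)"
    have "x \<in> S n k" for n k
      using INT_D[OF x UNIV_I, of "prod_encode (n, k)"] by simp
    then show "x \<in> (\<Inter>n. A n)" by (simp add: S(2))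
  qed (simp add: S(2))
  moreover have "\<forall>i. \<exists>\<gamma><\<alpha>. ?T i \<in> fun_add \<gamma>" using S(1) by simp
  ultimately show ?thesis
    unfolding fun_mult_pos[OF pos] by (intro exI[of _ ?T] conjI)
qed

lemma fun_add_UN:
  fixes A :: "nat \<Rightarrow> 'a::topological_space set"
  assumes "\<And>n. A n \<in> fun_add \<alpha>"
  shows "(\<Union>n. A n) \<in> fun_add \<alpha>"
  using fun_mult_INT[of "\<lambda>n. - A n"] assms by (simp add: fun_compl)

lemma fun_mult_Int: "A \<in> fun_mult \<alpha> \<Longrightarrow> B \<in> fun_mult \<alpha> \<Longrightarrow> A \<inter> B \<in> fun_mult \<alpha>"
proof -
  assume "A \<in> fun_mult \<alpha>" "B \<in> fun_mult \<alpha>"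
  then have "(\<Inter>n::nat. if n = 0 then A else B) \<in> fun_mult \<alpha>"
    by (intro fun_mult_INT) auto
  moreover have "(\<Inter>n::nat. if n = 0 then A else B) = A \<inter> B"
    by (auto split: if_splits)
  ultimately show ?thesis by simp
qed

text \<open>Intersection distributes over the two unions. Each \<open>S n \<inter> T k\<close>
  belongs to the multiplicative class of the larger of two indices, which is still below
  \<open>\<alpha>\<close>.\<close>

lemma fun_add_Int:
  assumes "A \<in> fun_add \<alpha>" "B \<in> fun_add \<alpha>"
  shows "A \<inter> B \<in> fun_add \<alpha>"
proof (cases "\<alpha> = 0")
  case True
  then show ?thesis using assms functionally_closed_Un[of "- A" "- B"]
    by (simp add: fun_add_0 functionally_open_def)
next
  case False
  then have pos: "0 < \<alpha>" by (simp add: order.not_eq_order_implies_strict)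
  obtain S T where S: "\<And>n::nat. \<exists>\<gamma><\<alpha>. S n \<in> fun_mult \<gamma>" "A = (\<Union>n. S n)"
    and T: "\<And>n::nat. \<exists>\<gamma><\<alpha>. T n \<in> fun_mult \<gamma>" "B = (\<Union>n. T n)"
    using assms unfolding fun_add_pos[OF pos] by blast
  have "S n \<inter> T k \<in> fun_add \<alpha>" for n k
  proof -
    obtain \<gamma> \<delta> where "\<gamma> < \<alpha>" "S n \<in> fun_mult \<gamma>" "\<delta> < \<alpha>" "T k \<in> fun_mult \<delta>"
      using S(1) T(1) by blast
    then show ?thesis
      using fun_mult_Int[of "S n" "max \<gamma> \<delta>" "T k"] fun_mult_mono fun_mult_imp_add
      by (metis max.cobounded1 max.cobounded2 max_less_iff_conj)
  qed
  then have "(\<Union>n k. S n \<inter> T k) \<in> fun_add \<alpha>" by (intro fun_add_UN)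
  moreover have "(\<Union>n k. S n \<inter> T k) = A \<inter> B" using S T by auto
  ultimately show ?thesis by simp
qed

section \<open>The algebra of ambiguous sets\<close>

lemma fun_ambiguous_compl: "A \<in> fun_ambiguous \<alpha> \<Longrightarrow> - A \<in> fun_ambiguous \<alpha>"
  using fun_compl[of A \<alpha>] fun_compl[of "- A" \<alpha>] by (simp add: fun_ambiguous_def)

lemma fun_ambiguous_Int:
  "A \<in> fun_ambiguous \<alpha> \<Longrightarrow> B \<in> fun_ambiguous \<alpha> \<Longrightarrow> A \<inter> B \<in> fun_ambiguous \<alpha>"
  by (simp add: fun_ambiguous_def fun_mult_Int fun_add_Int)

lemma fun_ambiguous_Diff:
  "A \<in> fun_ambiguous \<alpha> \<Longrightarrow> B \<in> fun_ambiguous \<alpha> \<Longrightarrow> A - B \<in> fun_ambiguous \<alpha>"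
  by (simp add: Diff_eq fun_ambiguous_Int fun_ambiguous_compl)

lemma fun_ambiguous_Un:
  assumes "A \<in> fun_ambiguous \<alpha>" "B \<in> fun_ambiguous \<alpha>"
  shows "A \<union> B \<in> fun_ambiguous \<alpha>"
proof -
  have "- (- A \<inter> - B) \<in> fun_ambiguous \<alpha>"
    by (intro fun_ambiguous_compl fun_ambiguous_Int assms)
  then show ?thesis by simp
qed

lemma fun_ambiguous_UNIV: "(UNIV :: 'a::topological_space set) \<in> fun_ambiguous \<alpha>"
proof -
  let ?U = "UNIV :: 'a set"
  have "?U \<in> fun_mult 0" "?U \<in> fun_add 0"
    by (simp_all add: fun_mult_0 fun_add_0 functionally_open_def
        functionally_closed_UNIV functionally_closed_empty)
  then show ?thesis
    using fun_mult_mono[of ?U 0 \<alpha>] fun_add_mono[of ?U 0 \<alpha>] by (simp add: fun_ambiguous_def)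
qed

lemma fun_ambiguous_empty: "{} \<in> fun_ambiguous \<alpha>"
  using fun_ambiguous_compl[OF fun_ambiguous_UNIV] by simp

lemma fun_ambiguous_UN:
  "finite I \<Longrightarrow> (\<And>i. i \<in> I \<Longrightarrow> A i \<in> fun_ambiguous \<alpha>) \<Longrightarrow> (\<Union>i\<in>I. A i) \<in> fun_ambiguous \<alpha>"
  by (induction rule: finite_induct) (simp_all add: fun_ambiguous_empty fun_ambiguous_Un)

lemma fun_ambiguous_INT:
  "finite I \<Longrightarrow> (\<And>i. i \<in> I \<Longrightarrow> A i \<in> fun_ambiguous \<alpha>) \<Longrightarrow> (\<Inter>i\<in>I. A i) \<in> fun_ambiguous \<alpha>"
  by (induction rule: finite_induct) (simp_all add: fun_ambiguous_UNIV fun_ambiguous_Int)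

lemma fun_ambiguous_disjointed:
  "(\<And>i. A i \<in> fun_ambiguous \<alpha>) \<Longrightarrow> disjointed A n \<in> fun_ambiguous \<alpha>"
  unfolding disjointed_def by (intro fun_ambiguous_Diff fun_ambiguous_UN) simp_all

lemma fun_ambiguous_mono: "A \<in> fun_ambiguous \<gamma> \<Longrightarrow> \<gamma> \<le> \<delta> \<Longrightarrow> A \<in> fun_ambiguous \<delta>"
  unfolding fun_ambiguous_def
  by (elim IntE, intro IntI) (erule (1) fun_mult_mono, erule (1) fun_add_mono)

lemma fun_mult_imp_ambiguous: "A \<in> fun_mult \<gamma> \<Longrightarrow> \<gamma> < \<delta> \<Longrightarrow> A \<in> fun_ambiguous \<delta>"
  unfolding fun_ambiguous_def
  by (intro IntI) (erule fun_mult_mono, erule less_imp_le, erule (1) fun_mult_imp_add)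

lemma fun_add_imp_ambiguous: "A \<in> fun_add \<gamma> \<Longrightarrow> \<gamma> < \<delta> \<Longrightarrow> A \<in> fun_ambiguous \<delta>"
  unfolding fun_ambiguous_def
  by (intro IntI) (erule (1) fun_add_imp_mult, erule fun_add_mono, erule less_imp_le)

section \<open>Stable Baire classes\<close>

lemma stable_baireI:
  assumes "0 < \<alpha>" "\<And>n. F n \<in> stable_baire_less \<alpha>" "stably_convergent F f"
  shows "f \<in> stable_baire \<alpha>"
  unfolding stable_baire_pos[OF assms(1)] stable_closure_def using assms(2,3) by blast

lemma stable_baire_lessI: "\<gamma> < \<alpha> \<Longrightarrow> f \<in> stable_baire \<gamma> \<Longrightarrow> f \<in> stable_baire_less \<alpha>"
  unfolding stable_baire_less_def by blast

lemma stable_baire_mono: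
  assumes "f \<in> stable_baire \<gamma>" "\<gamma> \<le> \<delta>"
  shows "f \<in> stable_baire \<delta>"
proof (cases "\<gamma> = \<delta>")
  case False
  then have "\<gamma> < \<delta>" using assms by simp
  then show ?thesis
    using assms(1) countable_ordinal_pos stable_baire_lessI
    by (intro stable_baireI[of _ "\<lambda>_. f"]) (simp_all add: stably_convergent_def)
qed (use assms in simp)

text \<open>A point caught by one \<open>X k\<close> stays in all later sets of the increasing
  sequence, so the values at it are correct from \<open>k\<close> on.\<close>

lemma exhausted_imp_stable_baire:
  assumes "0 < \<alpha>" "stably_exhausted \<alpha> \<beta> f"
  shows "f \<in> stable_baire \<alpha>"
proof -
  obtain X F where X: "incseq X" "(\<Union>n. X n) = UNIV"
    and F: "\<forall>n. F n \<in> stable_baire_less \<alpha>" "\<forall>n. \<forall>x\<in>X n. F n x = f x"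
    using assms(2) unfolding stably_exhausted_def by blast
  have "stably_convergent F f"
    unfolding stably_convergent_def
  proof
    fix x
    obtain k where "x \<in> X k" using X(2) by blast
    then have "x \<in> X n" if "n \<ge> k" for n using X(1) that by (meson monoD subsetD)
    then show "\<exists>k. \<forall>n\<ge>k. F n x = f x" using F(2) by blast
  qed
  then show ?thesis using F(1) assms(1) by (intro stable_baireI[of _ F]) simp_all
qed

section \<open>Piecewise continuous maps\<close>

text \<open>A partition is encoded by the function \<open>N\<close> that sends a point to the index
  of its piece. Disjointness and covering are then automatic, and partitions are refined by pairing
  index functions.\<close>

lemma piecewise_iff:
  "piecewise_continuous_on_ambiguous \<beta> f \<longleftrightarrow>
    (\<exists>N F. (\<forall>n::nat. {x. N x = n} \<in> fun_ambiguous \<beta>) \<and> (\<forall>n. continuous_on UNIV (F n)) \<and>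
      (\<forall>x. F (N x) x = f x))" (is "_ \<longleftrightarrow> ?R")
proof
  assume "piecewise_continuous_on_ambiguous \<beta> f"
  then obtain X F where X: "disjoint_family X" "(\<Union>n::nat. X n) = UNIV" "\<And>n. X n \<in> fun_ambiguous \<beta>"
    and F: "\<forall>n. continuous_on UNIV (F n)" "\<And>n x. x \<in> X n \<Longrightarrow> F n x = f x"
    unfolding piecewise_continuous_on_ambiguous_def by blast
  have "\<forall>x. \<exists>n. x \<in> X n" using X(2) by blast
  then obtain N where N: "\<And>x. x \<in> X (N x)" by metis
  have "{x. N x = n} = X n" for n
    using N disjoint_family_onD[OF X(1) UNIV_I UNIV_I] by (blast intro: sym)
  then show ?R using N F X(3) by (intro exI[of _ N] exI[of _ F]) simp
next
  assume ?R
  then obtain N F where "\<forall>n::nat. {x. N x = n} \<in> fun_ambiguous \<beta>" "\<forall>n. continuous_on UNIV (F n)"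
      "\<forall>x. F (N x) x = f x" by blast
  then show "piecewise_continuous_on_ambiguous \<beta> f"
    unfolding piecewise_continuous_on_ambiguous_def
    by (intro exI[of _ "\<lambda>n. {x. N x = n}"] exI[of _ F]) (auto simp: disjoint_family_on_def)
qed

lemma piecewise_mono:
  assumes "piecewise_continuous_on_ambiguous \<gamma> f" "\<gamma> \<le> \<delta>"
  shows "piecewise_continuous_on_ambiguous \<delta> f"
  using assms(1) fun_ambiguous_mono[OF _ assms(2)] unfolding piecewise_iff by meson

text \<open>Taking the first index turns a cover into a partition, and \<open>disjointed\<close>
  keeps the sets ambiguous.\<close>

lemma level_set_Least:
  fixes A :: "nat \<Rightarrow> 'a set"
  assumes "(\<Union>n. A n) = UNIV"
  shows "{x. (LEAST n. x \<in> A n) = n} = disjointed A n"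
proof -
  have ex: "\<exists>n. x \<in> A n" for x using assms by blast
  have "(LEAST n. x \<in> A n) = n \<longleftrightarrow> x \<in> A n \<and> (\<forall>i<n. x \<notin> A i)" for x
    using LeastI_ex[OF ex[of x]] not_less_Least[of _ "\<lambda>n. x \<in> A n"]
    by (metis (mono_tags, lifting) linorder_neqE_nat)
  then show ?thesis by (auto simp: disjointed_def)
qed

text \<open>The complement is cut along both partitions. On each cell it is the trace of a
  functionally open set, so it is a countable union of sets of additive class
  \<open>\<beta>\<close>.\<close>

lemma piecewise_eq_mult:
  fixes g h :: "'a::topological_space \<Rightarrow> 'b::topological_space"
  assumes diagonal: "functionally_closed {(y, y) | y :: 'b. True}"
    and "piecewise_continuous_on_ambiguous \<beta> g" "piecewise_continuous_on_ambiguous \<beta> h"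
  shows "{x. g x = h x} \<in> fun_mult \<beta>"
proof -
  obtain N G where N: "\<And>n::nat. {x. N x = n} \<in> fun_ambiguous \<beta>"
    and G: "\<And>n. continuous_on UNIV (G n)" "\<And>x. G (N x) x = g x"
    using assms(2) unfolding piecewise_iff by blast
  obtain M H where M: "\<And>n::nat. {x. M x = n} \<in> fun_ambiguous \<beta>"
    and H: "\<And>n. continuous_on UNIV (H n)" "\<And>x. H (M x) x = h x"
    using assms(3) unfolding piecewise_iff by blast
  have "- {x. G i x = H j x} \<in> fun_add 0" for i j
    unfolding fun_add_0 functionally_open_def
    using functionally_closed_eq[OF diagonal G(1) H(1)] by simp
  then have "- {x. G i x = H j x} \<in> fun_add \<beta>" for i j
    by (rule fun_add_mono) simp
  then have *: "(\<Union>i j. {x. N x = i} \<inter> {x. M x = j} \<inter> - {x. G i x = H j x}) \<in> fun_add \<beta>"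
    using N M unfolding fun_ambiguous_def by (intro fun_add_UN fun_add_Int) blast+
  have "(\<Union>i j. {x. N x = i} \<inter> {x. M x = j} \<inter> - {x. G i x = H j x}) = - {x. g x = h x}"
    by (auto simp: G(2) H(2))
  from *[unfolded this] show ?thesis by (simp only: fun_compl)
qed

section \<open>From stable limits to piecewise continuity\<close>

text \<open>The assumption \<open>IH\<close> is the implication from (1) to (3) below
  \<open>\<alpha>\<close>; a transfinite induction discharges it in
  \<open>stable_baire_imp_piecewise\<close>.\<close>

lemma stable_baire_imp_exhausted:
  fixes f :: "'a::topological_space \<Rightarrow> 'b::topological_space"
  assumes diagonal: "functionally_closed {(y, y) | y :: 'b. True}"
    and pos: "0 < \<alpha>"
    and IH: "\<And>\<gamma> g :: 'a \<Rightarrow> 'b. \<gamma> < \<alpha> \<Longrightarrow> g \<in> stable_baire \<gamma> \<Longrightarrow>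
      piecewise_continuous_on_ambiguous (class_shift \<gamma>) g"
    and f: "f \<in> stable_baire \<alpha>"
  shows "stably_exhausted \<alpha> (class_shift \<alpha>) f"
proof -
  obtain F where F: "\<And>n. F n \<in> stable_baire_less \<alpha>" and conv: "stably_convergent F f"
    using f unfolding stable_baire_pos[OF pos] stable_closure_def by blast
  have Fn: "\<exists>\<gamma><\<alpha>. F n \<in> stable_baire \<gamma>" for n
    using F[of n] unfolding stable_baire_less_def by blast
  \<comment> \<open>The sets \<open>X n\<close> below compare infinitely many maps, so one class
    \<open>\<delta>\<close> must serve them all. Finite and infinite \<open>\<alpha>\<close> part
    ways here.\<close>
  have "\<exists>\<delta><class_shift \<alpha>. \<forall>n. piecewise_continuous_on_ambiguous \<delta> (F n)"
  proof (cases "\<alpha> < ord_omega0")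
    case True
    \<comment> \<open>A finite positive \<open>\<alpha>\<close> has a predecessor, whose stable
      class contains every \<open>F n\<close>.\<close>
    define \<kappa> where "\<kappa> = Max {..<\<alpha>}"
    have fin: "finite {..<\<alpha>}" using True by (simp add: less_ord_omega0_iff)
    have "\<kappa> < \<alpha>" using Max_in[OF fin] pos unfolding \<kappa>_def by blast
    have "F n \<in> stable_baire \<kappa>" for n
      using Fn[of n] Max_ge[OF fin] stable_baire_mono unfolding \<kappa>_def by blast
    then have "piecewise_continuous_on_ambiguous (class_shift \<kappa>) (F n)" for n
      using IH[OF \<open>\<kappa> < \<alpha>\<close>] by blast
    moreover have "class_shift \<kappa> < class_shift \<alpha>"
      using True \<open>\<kappa> < \<alpha>\<close> less_trans[OF \<open>\<kappa> < \<alpha>\<close> True] by (simp add: class_shift_def)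
    ultimately show ?thesis by blast
  next
    case False
    \<comment> \<open>The classes of the \<open>F n\<close> may have no common bound below an
      infinite \<open>\<alpha>\<close>, but their shifts are at most \<open>\<alpha>\<close>. The
      extra successor in \<open>class_shift \<alpha>\<close> makes \<open>\<alpha>\<close> itself an
      admissible \<open>\<delta>\<close>.\<close>
    have "piecewise_continuous_on_ambiguous \<alpha> (F n)" for n
      using Fn[of n] IH piecewise_mono class_shift_le by blast
    then show ?thesis using False less_ord_succ[of \<alpha>] by (auto simp: class_shift_def)
  qed
  then obtain \<delta> where \<delta>: "\<delta> < class_shift \<alpha>" "\<And>n. piecewise_continuous_on_ambiguous \<delta> (F n)"
    by blast
  \<comment> \<open>On this set the sequence is constant from \<open>n\<close> on, so its value
    there is already the limit.\<close>
  define X where "X n = (\<Inter>m. {x. F (n + m) x = F n x})" for n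
  have "X n \<in> fun_mult \<delta>" for n
    unfolding X_def by (intro fun_mult_INT piecewise_eq_mult[OF diagonal] \<delta>)
  then have "X n \<in> fun_mult_less (class_shift \<alpha>)" for n
    using \<delta>(1) unfolding fun_mult_less_def by blast
  moreover have "incseq X"
  proof (rule incseq_SucI, rule subsetI)
    fix n x assume "x \<in> X n"
    then have *: "F (n + m) x = F n x" for m by (simp add: X_def)
    show "x \<in> X (Suc n)"
      using *[of "Suc _"] *[of 1] by (simp add: X_def)
  qed
  moreover have "(\<Union>n. X n) = UNIV"
  proof -
    have "\<exists>n. x \<in> X n" for x
    proof -
      obtain k where "\<forall>n\<ge>k. F n x = f x" using conv unfolding stably_convergent_def by blast
      then have "x \<in> X k" by (simp add: X_def)
      then show ?thesis ..
    qed
    then show ?thesis by blast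
  qed
  moreover have "F n x = f x" if "x \<in> X n" for n x
  proof -
    obtain k where "\<forall>n\<ge>k. F n x = f x" using conv unfolding stably_convergent_def by blast
    then have "F (n + k) x = f x" by simp
    then show ?thesis using that by (simp add: X_def)
  qed
  ultimately show ?thesis
    unfolding stably_exhausted_def using F by (intro exI[of _ X] exI[of _ F]) simp
qed

text \<open>Each \<open>X n\<close> has a lower multiplicative class and is therefore ambiguous. The
  partition by the first \<open>X n\<close> containing a point is refined by the partition that
  belongs to \<open>F n\<close>.\<close>

lemma exhausted_imp_piecewise:
  fixes f :: "'a::topological_space \<Rightarrow> 'b::topological_space"
  assumes IH: "\<And>\<gamma> g :: 'a \<Rightarrow> 'b. \<gamma> < \<alpha> \<Longrightarrow> g \<in> stable_baire \<gamma> \<Longrightarrow>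
      piecewise_continuous_on_ambiguous (class_shift \<gamma>) g"
    and f: "stably_exhausted \<alpha> (class_shift \<alpha>) f"
  shows "piecewise_continuous_on_ambiguous (class_shift \<alpha>) f"
proof -
  obtain X F where X: "\<And>n. X n \<in> fun_mult_less (class_shift \<alpha>)" "(\<Union>n::nat. X n) = UNIV"
    and F: "\<And>n. F n \<in> stable_baire_less \<alpha>" "\<And>n x. x \<in> X n \<Longrightarrow> F n x = f x"
    using f unfolding stably_exhausted_def by blast
  have "piecewise_continuous_on_ambiguous (class_shift \<alpha>) (F n)" for n
    using F(1)[of n] IH piecewise_mono class_shift_mono[OF less_imp_le]
    unfolding stable_baire_less_def by blast
  then have "\<forall>n. \<exists>M G. (\<forall>k::nat. {x. M x = k} \<in> fun_ambiguous (class_shift \<alpha>)) \<and>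
      (\<forall>k. continuous_on UNIV (G k)) \<and> (\<forall>x. G (M x) x = F n x)"
    unfolding piecewise_iff by blast
  from choice[OF this] obtain M where "\<forall>n. \<exists>G. (\<forall>k::nat. {x. M n x = k} \<in> fun_ambiguous (class_shift \<alpha>)) \<and>
      (\<forall>k. continuous_on UNIV (G k)) \<and> (\<forall>x. G (M n x) x = F n x)" ..
  from choice[OF this] obtain G where "\<forall>n. (\<forall>k::nat. {x. M n x = k} \<in> fun_ambiguous (class_shift \<alpha>)) \<and>
      (\<forall>k. continuous_on UNIV (G n k)) \<and> (\<forall>x. G n (M n x) x = F n x)" ..
  then have M: "{x. M n x = k} \<in> fun_ambiguous (class_shift \<alpha>)"
    and G: "continuous_on UNIV (G n k)" "G n (M n x) x = F n x" for n k x
    by simp_all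
  have amb: "X n \<in> fun_ambiguous (class_shift \<alpha>)" for n
  proof -
    obtain \<gamma> where "\<gamma> < class_shift \<alpha>" "X n \<in> fun_mult \<gamma>"
      using X(1)[of n] unfolding fun_mult_less_def by blast
    then show ?thesis by (intro fun_mult_imp_ambiguous)
  qed
  define L where "L x = (LEAST n. x \<in> X n)" for x
  have L: "x \<in> X (L x)" for x
    unfolding L_def by (rule LeastI_ex) (use X(2) in auto)
  \<comment> \<open>The new index records both the first set containing \<open>x\<close> and the
    piece of the corresponding map.\<close>
  define N where "N x = prod_encode (L x, M (L x) x)" for x
  have "{x. N x = i} \<in> fun_ambiguous (class_shift \<alpha>)" for i
  proof -
    obtain n k where i: "i = prod_encode (n, k)" by (metis prod_decode_inverse surj_pair)
    have "{x. N x = i} = disjointed X n \<inter> {x. M n x = k}"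
      unfolding level_set_Least[OF X(2), symmetric] by (auto simp: N_def i L_def)
    then show ?thesis
      by (simp add: fun_ambiguous_Int fun_ambiguous_disjointed amb M)
  qed
  moreover have "case_prod G (prod_decode (N x)) x = f x" for x
    using L F(2) G(2) by (simp add: N_def)
  moreover have "continuous_on UNIV (case_prod G (prod_decode i))" for i
    using G(1) by (simp add: case_prod_beta)
  ultimately show ?thesis
    unfolding piecewise_iff
    by (intro exI[of _ N] exI[of _ "\<lambda>i. case_prod G (prod_decode i)"]) simp
qed

text \<open>Transfinite induction passing through (2) at every positive stage. A continuous map is
  handled by the partition with a single nonempty piece.\<close>

lemma stable_baire_imp_piecewise:
  fixes f :: "'a::topological_space \<Rightarrow> 'b::topological_space"
  assumes diagonal: "functionally_closed {(y, y) | y :: 'b. True}"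
    and "f \<in> stable_baire \<alpha>"
  shows "piecewise_continuous_on_ambiguous (class_shift \<alpha>) f"
  using assms(2)
proof (induction \<alpha> arbitrary: f rule: less_induct)
  case (less \<alpha>)
  show ?case
  proof (cases "\<alpha> = 0")
    case True
    then have "continuous_on UNIV f" using less.prems by (simp add: stable_baire_0)
    then show ?thesis
      unfolding piecewise_iff
      by (intro exI[of _ "\<lambda>_. 0"] exI[of _ "\<lambda>_. f"])
        (simp add: fun_ambiguous_UNIV fun_ambiguous_empty)
  next
    case False
    then have "0 < \<alpha>" by (simp add: order.not_eq_order_implies_strict)
    show ?thesis
      by (rule exhausted_imp_piecewise[OF less.IH
        stable_baire_imp_exhausted[OF diagonal \<open>0 < \<alpha>\<close> less.IH less.prems]])
  qed
qed

section \<open>Multiplicative sets as intersections of ambiguous sets of lower class\<close>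

text \<open>For positive \<open>\<gamma>\<close>, \<open>C\<close> is an intersection of sets of
  additive classes \<open>\<delta> < \<gamma>\<close>, each ambiguous of class
  \<open>ord_succ \<delta>\<close>. That class is \<open>class_shift \<kappa>\<close> for
  \<open>\<kappa> = ord_succ \<delta>\<close> if \<open>\<delta>\<close> is finite and for
  \<open>\<kappa> = \<delta>\<close> otherwise. If \<open>\<gamma> = 0\<close>, the hypothesis
  \<open>1 < \<alpha>\<close> makes \<open>\<kappa> = 1\<close> available.\<close>

lemma fun_mult_decompose:
  assumes "1 < \<alpha>" "\<gamma> < class_shift \<alpha>" "C \<in> fun_mult \<gamma>"
  shows "\<exists>B. C = (\<Inter>j::nat. B j) \<and> (\<forall>j. \<exists>\<kappa>\<ge>1. \<kappa> < \<alpha> \<and> B j \<in> fun_ambiguous (class_shift \<kappa>))"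
proof (cases "\<gamma> = 0")
  case True
  have "C \<in> fun_ambiguous 1"
    using assms(3) True by (auto intro!: fun_mult_imp_ambiguous simp flip: one_le_countable_ordinal_iff)
  then have "\<exists>\<kappa>\<ge>1. \<kappa> < \<alpha> \<and> C \<in> fun_ambiguous (class_shift \<kappa>)"
    using assms(1) by (intro exI[of _ 1]) simp
  then show ?thesis by (intro exI[of _ "\<lambda>_. C"]) simp
next
  case False
  then have pos: "0 < \<gamma>" by (simp add: order.not_eq_order_implies_strict)
  obtain B where B: "\<forall>n::nat. \<exists>\<delta><\<gamma>. B n \<in> fun_add \<delta>" "C = (\<Inter>n. B n)"
    using assms(3) unfolding fun_mult_pos[OF pos] by blast
  have "\<exists>\<kappa>\<ge>1. \<kappa> < \<alpha> \<and> B j \<in> fun_ambiguous (class_shift \<kappa>)" for j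
  proof -
    obtain \<delta> where \<delta>: "\<delta> < \<gamma>" "B j \<in> fun_add \<delta>" using B(1) by blast
    have amb: "B j \<in> fun_ambiguous (ord_succ \<delta>)"
      by (rule fun_add_imp_ambiguous[OF \<delta>(2) less_ord_succ])
    show ?thesis
    proof (cases "\<delta> < ord_omega0")
      case True
      have "1 \<le> ord_succ \<delta>"
        unfolding one_le_countable_ordinal_iff by (rule countable_ordinal_pos[OF less_ord_succ])
      \<comment> \<open>For finite \<open>\<alpha>\<close> there is a chain through
        \<open>\<gamma>\<close>; for infinite \<open>\<alpha>\<close> the successor of a finite
        ordinal is still finite.\<close>
      moreover have "ord_succ \<delta> < \<alpha>"
      proof (cases "\<alpha> < ord_omega0")
        case True
        then have "\<gamma> < \<alpha>" using assms(2) by (simp add: class_shift_def)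
        moreover have "ord_succ \<delta> \<le> \<gamma>" using \<delta>(1) by (simp add: ord_succ_le_iff)
        ultimately show ?thesis by simp
      next
        case False
        then show ?thesis using ord_succ_less_omega0[OF True] by simp
      qed
      moreover have "class_shift (ord_succ \<delta>) = ord_succ \<delta>"
        using ord_succ_less_omega0[OF True] by (simp add: class_shift_def)
      ultimately show ?thesis using amb by (intro exI[of _ "ord_succ \<delta>"]) simp
    next
      case False
      have "\<delta> < \<alpha>"
      proof (rule ccontr)
        assume "\<not> \<delta> < \<alpha>"
        then have "\<alpha> < \<gamma>" using \<delta>(1) by simp
        then have "class_shift \<alpha> \<le> \<gamma>" by (rule class_shift_le)
        then show False using assms(2) by simp
      qed
      moreover have "1 \<le> \<delta>" using False one_less_omega0 by simp
      ultimately show ?thesis using False amb by (intro exI[of _ \<delta>]) (simp add: class_shift_def)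
    qed
  qed
  then show ?thesis using B(2) by (intro exI[of _ B]) simp
qed

section \<open>Gluing continuous maps on finitely many closed sets\<close>

text \<open>This is the common consequence of the two adhesive hypotheses. The index
  \<open>m i\<close> selects the member of the family that receives the image of \<open>A i\<close>;
  in case (a) the family is constantly \<open>UNIV\<close>.\<close>

definition finite_gluing :: "(nat \<Rightarrow> 'b::topological_space set) \<Rightarrow> 'a::topological_space itself \<Rightarrow> bool" where
  "finite_gluing E X \<longleftrightarrow>
     (\<forall>(n::nat) (A :: nat \<Rightarrow> 'a set) (g :: nat \<Rightarrow> 'a \<Rightarrow> 'b) m.
        (\<forall>i<n. functionally_closed (A i) \<and> continuous_on UNIV (g i) \<and> g i ` A i \<subseteq> E (m i)) \<and>
        (\<forall>i<n. \<forall>j<n. i \<noteq> j \<longrightarrow> A i \<inter> A j = {}) \<longrightarrow>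
        (\<exists>h. continuous_on UNIV h \<and> (\<forall>i<n. \<forall>x\<in>A i. h x = g i x)))"

text \<open>The union of the sets treated so far is functionally closed, so one application of the
  adhesive property attaches the next set.\<close>

lemma finite_gluing_adhesive:
  assumes "adhesive_for TYPE('b::topological_space) TYPE('a::topological_space)"
  shows "finite_gluing (\<lambda>_. UNIV :: 'b set) TYPE('a)"
proof -
  have "\<exists>h. continuous_on UNIV h \<and> (\<forall>i<n. \<forall>x\<in>A i. h x = g i x)"
    if "\<forall>i<n. functionally_closed (A i) \<and> continuous_on UNIV (g i)"
      "\<forall>i<n. \<forall>j<n. i \<noteq> j \<longrightarrow> A i \<inter> A j = {}"
    for n :: nat and A :: "nat \<Rightarrow> 'a set" and g :: "nat \<Rightarrow> 'a \<Rightarrow> 'b"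
    using that
  proof (induction n)
    case 0
    show ?case by (intro exI[of _ "\<lambda>_. undefined"]) simp
  next
    case (Suc n)
    have "\<exists>h. continuous_on UNIV h \<and> (\<forall>i<n. \<forall>x\<in>A i. h x = g i x)"
      by (rule Suc.IH) (use Suc.prems in simp_all)
    then obtain h where h: "continuous_on UNIV h" "\<forall>i<n. \<forall>x\<in>A i. h x = g i x" by blast
    have "functionally_closed (\<Union>i<n. A i)"
      by (rule functionally_closed_UN) (use Suc.prems(1) in auto)
    moreover have "functionally_closed (A n)" "continuous_on UNIV (g n)"
      using Suc.prems(1) by auto
    moreover have "(\<Union>i<n. A i) \<inter> A n = {}"
    proof -
      have "A i \<inter> A n = {}" if "i < n" for i using Suc.prems(2) that by simp
      then show ?thesis by blast
    qed
    ultimately obtain h' where h': "continuous_on UNIV h'" "\<forall>x\<in>\<Union>i<n. A i. h' x = h x"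
        "\<forall>x\<in>A n. h' x = g n x"
      using assms[unfolded adhesive_for_def, rule_format, of "\<Union>i<n. A i" "A n" h "g n"] h(1) by blast
    have "h' x = g i x" if "i < Suc n" "x \<in> A i" for i x
      using that h' h(2) by (cases "i = n") auto
    then show ?case using h'(1) by blast
  qed
  then show ?thesis
    unfolding finite_gluing_def by simp
qed

lemma continuous_on_paste_le:
  fixes u :: "'a::topological_space \<Rightarrow> real"
  assumes "continuous_on UNIV u" "continuous_on UNIV f" "continuous_on UNIV g"
    and "\<And>x. u x = c \<Longrightarrow> f x = g x"
  shows "continuous_on UNIV (\<lambda>x. if u x \<le> c then f x else g x)"
proof -
  have "closed {x. u x \<le> c}" "closed {x. c \<le> u x}"
    using assms(1) by (auto intro!: closed_Collect_le continuous_intros)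
  moreover have "{x. u x \<le> c} \<union> {x. c \<le> u x} = UNIV" by auto
  ultimately show ?thesis
    using continuous_on_cases[of "{x. u x \<le> c}" "{x. c \<le> u x}" f g "\<lambda>x. u x \<le> c"] assms
    by (metis (mono_tags, lifting) continuous_on_subset dual_order.antisym mem_Collect_eq subset_UNIV)
qed

text \<open>A path from the distinguished point to \<open>y0\<close> makes every point admissible as the constant value.\<close>

lemma star_adhesive_any_point:
  fixes f :: "'a::topological_space \<Rightarrow> 'b::topological_space"
  assumes pc: "path_connected (UNIV :: 'b set)" and "star_adhesive_for E TYPE('a)"
    and f: "continuous_on UNIV f" "functionally_closed A" "functionally_closed B" "A \<inter> B = {}" "f ` A \<subseteq> E"
  obtains h where "continuous_on UNIV h" "\<forall>x\<in>A. h x = f x" "\<forall>x\<in>B. h x = y0"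
proof -
  obtain y where y: "\<forall>(f :: 'a \<Rightarrow> 'b) A B. continuous_on UNIV f \<and> functionally_closed A \<and>
      functionally_closed B \<and> A \<inter> B = {} \<and> f ` A \<subseteq> E \<longrightarrow>
      (\<exists>h. continuous_on UNIV h \<and> (\<forall>x\<in>A. h x = f x) \<and> (\<forall>x\<in>B. h x = y))"
    using assms(2) unfolding star_adhesive_for_def by (rule bexE)
  obtain u :: "'a \<Rightarrow> real" where u: "continuous_on UNIV u" "range u \<subseteq> {0..1}"
      "\<forall>x\<in>A. u x = 0" "\<forall>x\<in>B. u x = 1"
    by (rule functionally_closed_separate[OF f(2-4)])
  \<comment> \<open>Prescribing the value \<open>y\<close> already from level 1/2 on leaves a zone
    in front of \<open>B\<close> in which to follow the path.\<close>
  have "functionally_closed {x. 1/2 \<le> u x}"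
    by (intro functionally_closed_le continuous_intros u)
  moreover have "A \<inter> {x. 1/2 \<le> u x} = {}" using u(3) by auto
  ultimately obtain h where h: "continuous_on UNIV h" "\<forall>x\<in>A. h x = f x" "\<forall>x\<in>{x. 1/2 \<le> u x}. h x = y"
    using y[rule_format, of f A "{x. 1/2 \<le> u x}"] f(1,2,5) by blast
  obtain p where p: "path p" "pathstart p = y" "pathfinish p = y0"
    using pc unfolding path_connected_def by blast
  \<comment> \<open>\<open>v\<close> is 0 up to level 1/2 of \<open>u\<close> and 1 on
    \<open>B\<close>. So \<open>p (v x)\<close> leads from \<open>y\<close> to \<open>y0\<close> and
    matches \<open>h\<close> on the level 1/2.\<close>
  define v where "v x = max 0 (2 * u x - 1)" for x
  have v: "continuous_on UNIV v" unfolding v_def by (intro continuous_intros u)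
  have "range v \<subseteq> {0..1}"
    using u(2) by (auto simp: v_def image_subset_iff)
  then have pv: "continuous_on UNIV (\<lambda>x. p (v x))"
    using p(1) unfolding path_def by (rule continuous_on_compose2[OF _ v, rotated])
  show thesis
  proof
    show "continuous_on UNIV (\<lambda>x. if u x \<le> 1/2 then h x else p (v x))"
      using h(3) p(2) by (intro continuous_on_paste_le u h pv) (auto simp: v_def pathstart_def)
    show "\<forall>x\<in>A. (if u x \<le> 1/2 then h x else p (v x)) = f x"
      using u(3) h(2) by simp
    show "\<forall>x\<in>B. (if u x \<le> 1/2 then h x else p (v x)) = y0"
      using u(4) p(3) by (simp add: v_def pathfinish_def)
  qed
qed

text \<open>Different sets \<open>E n\<close> may come with different distinguished points.
  Path-connectedness replaces these by one arbitrary common point \<open>y0\<close>, which lets maps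
  into different \<open>E n\<close> be pasted.\<close>

lemma finite_gluing_star_adhesive:
  fixes E :: "nat \<Rightarrow> 'b::topological_space set"
  assumes pc: "path_connected (UNIV :: 'b set)"
    and star: "\<And>n. star_adhesive_for (E n) TYPE('a::topological_space)"
  shows "finite_gluing E TYPE('a)"
proof -
  fix y0 :: 'b
  text \<open>For the induction, the glued map must also be the constant \<open>y0\<close> on a further closed set:
    two maps that are both \<open>y0\<close> on a level set separating their domains can be pasted.\<close>
  have glue: "\<exists>h. continuous_on UNIV h \<and> (\<forall>i<n. \<forall>x\<in>A i. h x = g i x) \<and> (\<forall>x\<in>B. h x = y0)"
    if "\<forall>i<n. functionally_closed (A i) \<and> continuous_on UNIV (g i) \<and> g i ` A i \<subseteq> E (m i)"
      "\<forall>i<n. \<forall>j<n. i \<noteq> j \<longrightarrow> A i \<inter> A j = {}"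
      "functionally_closed B" "\<forall>i<n. A i \<inter> B = {}"
    for n :: nat and A :: "nat \<Rightarrow> 'a set" and g :: "nat \<Rightarrow> 'a \<Rightarrow> 'b" and m :: "nat \<Rightarrow> nat" and B
    using that
  proof (induction n arbitrary: B)
    case 0
    show ?case by (intro exI[of _ "\<lambda>_. y0"]) simp
  next
    case (Suc n)
    have An: "functionally_closed (A n)" "continuous_on UNIV (g n)" "g n ` A n \<subseteq> E (m n)"
      using Suc.prems(1) by auto
    have fc: "functionally_closed ((\<Union>i<n. A i) \<union> B)"
      by (intro functionally_closed_Un functionally_closed_UN) (use Suc.prems(1,3) in auto)
    have disj: "A n \<inter> ((\<Union>i<n. A i) \<union> B) = {}"
    proof -
      have "A i \<inter> A n = {}" if "i < n" for i using Suc.prems(2) that by simp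
      moreover have "A n \<inter> B = {}" using Suc.prems(4) by simp
      ultimately show ?thesis by blast
    qed
    obtain u :: "'a \<Rightarrow> real" where u: "continuous_on UNIV u"
        "\<forall>x\<in>A n. u x = 0" "\<forall>x\<in>(\<Union>i<n. A i) \<union> B. u x = 1"
      by (rule functionally_closed_separate[OF An(1) fc disj])
    have le: "functionally_closed {x. u x \<le> 1/2}" and ge: "functionally_closed {x. 1/2 \<le> u x}"
      by (intro functionally_closed_le continuous_intros u)+
    have "A n \<inter> {x. 1/2 \<le> u x} = {}" using u(2) by auto
    then obtain h1 where h1: "continuous_on UNIV h1" "\<forall>x\<in>A n. h1 x = g n x"
        "\<forall>x\<in>{x. 1/2 \<le> u x}. h1 x = y0"
      by (rule star_adhesive_any_point[OF pc star An(2,1) ge _ An(3)])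
    \<comment> \<open>The enlarged closed set still misses every \<open>A i\<close> with
      \<open>i < n\<close>, because \<open>u\<close> is 1 there.\<close>
    have "\<exists>h. continuous_on UNIV h \<and> (\<forall>i<n. \<forall>x\<in>A i. h x = g i x) \<and>
        (\<forall>x\<in>B \<union> {x. u x \<le> 1/2}. h x = y0)"
    proof (rule Suc.IH)
      show "functionally_closed (B \<union> {x. u x \<le> 1/2})"
        by (intro functionally_closed_Un Suc.prems(3) le)
      show "\<forall>i<n. A i \<inter> (B \<union> {x. u x \<le> 1/2}) = {}"
      proof (intro allI impI)
        fix i assume "i < n"
        then have "A i \<inter> B = {}" "\<forall>x\<in>A i. u x = 1" using Suc.prems(4) u(3) by auto
        then show "A i \<inter> (B \<union> {x. u x \<le> 1/2}) = {}" by auto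
      qed
    qed (use Suc.prems(1,2) in auto)
    then obtain h2 where h2: "continuous_on UNIV h2" "\<forall>i<n. \<forall>x\<in>A i. h2 x = g i x"
        "\<forall>x\<in>B \<union> {x. u x \<le> 1/2}. h2 x = y0" by blast
    let ?h = "\<lambda>x. if u x \<le> 1/2 then h1 x else h2 x"
    have "continuous_on UNIV ?h"
      using h1(3) h2(3) by (intro continuous_on_paste_le u h1 h2) auto
    moreover have "?h x = g i x" if "i < Suc n" "x \<in> A i" for i x
    proof (cases "i = n")
      case True then show ?thesis using that u(2) h1(2) by simp
    next
      case False
      then have "i < n" using that by simp
      then have "u x = 1" using that u(3) by blast
      then show ?thesis using \<open>i < n\<close> that h2(2) by simp
    qed
    moreover have "?h x = y0" if "x \<in> B" for x
      using that u(3) h2(3) by simp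
    ultimately show ?case by (intro exI[of _ ?h]) blast
  qed
  show ?thesis
    unfolding finite_gluing_def
  proof (intro allI impI, elim conjE)
    fix n :: nat and A :: "nat \<Rightarrow> 'a set" and g :: "nat \<Rightarrow> 'a \<Rightarrow> 'b" and m :: "nat \<Rightarrow> nat"
    assume "\<forall>i<n. functionally_closed (A i) \<and> continuous_on UNIV (g i) \<and> g i ` A i \<subseteq> E (m i)"
      "\<forall>i<n. \<forall>j<n. i \<noteq> j \<longrightarrow> A i \<inter> A j = {}"
    then show "\<exists>h. continuous_on UNIV h \<and> (\<forall>i<n. \<forall>x\<in>A i. h x = g i x)"
      using glue[of n A g m "{}"] by (simp add: functionally_closed_empty)
  qed
qed

section \<open>From ambiguous pieces back to stable limits\<close>

text \<open>Pieces of class 1 are countable unions of functionally closed sets. Closed parts of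
  finitely many pieces are disjoint, so the maps on them can be glued, and these parts eventually
  catch every point.\<close>

lemma piecewise_imp_stable_baire_1:
  fixes f :: "'a::topological_space \<Rightarrow> 'b::topological_space" and E :: "nat \<Rightarrow> 'b set"
  assumes glue: "finite_gluing E TYPE('a)"
    and E: "(\<Union>n. E n) = UNIV" "\<And>n. functionally_closed (E n)"
    and f: "piecewise_continuous_on_ambiguous 1 f"
  shows "f \<in> stable_baire 1"
proof -
  have pos: "(0::countable_ordinal) < 1" by (simp flip: one_le_countable_ordinal_iff)
  obtain N F where N: "\<And>n::nat. {x. N x = n} \<in> fun_ambiguous 1"
    and F: "\<And>n. continuous_on UNIV (F n)" "\<And>x. F (N x) x = f x"
    using f unfolding piecewise_iff by blast
  \<comment> \<open>Gluing requires that each piece be mapped into a single \<open>E k\<close>, so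
    the pieces are split by the first \<open>k\<close> that receives the value.\<close>
  define K where "K i x = (LEAST k. x \<in> F i -` E k)" for i x
  have cover: "(\<Union>k. F i -` E k) = UNIV" for i using E(1) by blast
  have K: "F i x \<in> E (K i x)" for i x
  proof -
    have "\<exists>k. x \<in> F i -` E k" using cover[of i] by auto
    then have "x \<in> F i -` E (K i x)" unfolding K_def by (rule LeastI_ex)
    then show ?thesis by simp
  qed
  have amb: "F i -` E k \<in> fun_ambiguous 1" for i k
    by (rule fun_mult_imp_ambiguous[OF _ pos])
      (simp add: fun_mult_0 functionally_closed_vimage E(2) F(1))
  define D where "D i = {x. prod_encode (N x, K (N x) x) = i}" for i
  define G where "G i = F (fst (prod_decode i))" for i
  define m where "m i = snd (prod_decode i)" for i
  have D: "D i \<in> fun_ambiguous 1" for i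
  proof -
    obtain n k where i: "i = prod_encode (n, k)" by (metis prod_decode_inverse surj_pair)
    have "D i = {x. N x = fst (prod_decode i)} \<inter> {x. K (fst (prod_decode i)) x = m i}"
      by (auto simp: D_def m_def i)
    also have "{x. K (fst (prod_decode i)) x = m i} = disjointed (\<lambda>k. F (fst (prod_decode i)) -` E k) (m i)"
      unfolding K_def by (rule level_set_Least[OF cover])
    finally show ?thesis by (simp add: fun_ambiguous_Int fun_ambiguous_disjointed amb N)
  qed
  have GD: "G i x = f x" "G i x \<in> E (m i)" if "x \<in> D i" for i x
    using that F(2) K[of "N x" x] by (auto simp: D_def G_def m_def)
  \<comment> \<open>The only class below 1 is 0, so additive class 1 means countable unions of
    functionally closed sets.\<close>
  have "\<forall>i. \<exists>S. (\<forall>k::nat. functionally_closed (S k)) \<and> D i = (\<Union>k. S k)"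
  proof
    fix i
    obtain S where S: "\<forall>k::nat. \<exists>\<gamma><1. S k \<in> fun_mult \<gamma>" "D i = (\<Union>k. S k)"
      using D[of i] unfolding fun_ambiguous_def Int_iff fun_add_pos[OF pos] by blast
    have "\<gamma> = 0" if "\<gamma> < 1" for \<gamma> :: countable_ordinal
      using that one_le_countable_ordinal_iff[of \<gamma>] countable_ordinal_zero_le[of \<gamma>]
      by (metis leD order.not_eq_order_implies_strict)
    then have "functionally_closed (S k)" for k
      using S(1) by (metis fun_mult_0)
    then show "\<exists>S. (\<forall>k::nat. functionally_closed (S k)) \<and> D i = (\<Union>k. S k)"
      using S(2) by (intro exI[of _ S]) simp
  qed
  from choice[OF this] obtain S
    where "\<forall>i. (\<forall>k::nat. functionally_closed (S i k)) \<and> D i = (\<Union>k. S i k)" ..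
  then have S: "functionally_closed (S i k)" "D i = (\<Union>k. S i k)" for i k by simp_all
  have "\<exists>h. continuous_on UNIV h \<and> (\<forall>i<n. \<forall>x\<in>\<Union>k\<le>n. S i k. h x = G i x)" for n
  proof (rule glue[unfolded finite_gluing_def, rule_format, of n _ G m], intro conjI allI impI)
    show "functionally_closed (\<Union>k\<le>n. S i k)" for i
      by (rule functionally_closed_UN) (simp_all add: S(1))
    show "continuous_on UNIV (G i)" for i by (simp add: G_def F(1))
    have sub: "(\<Union>k\<le>n. S i k) \<subseteq> D i" for i using S(2) by blast
    then show "G i ` (\<Union>k\<le>n. S i k) \<subseteq> E (m i)" for i using GD(2) by blast
    show "(\<Union>k\<le>n. S i k) \<inter> (\<Union>k\<le>n. S j k) = {}" if "i \<noteq> j" for i j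
    proof -
      have "D i \<inter> D j = {}" using that by (auto simp: D_def)
      then show ?thesis using sub[of i] sub[of j] by blast
    qed
  qed
  from choice[OF allI[OF this]] obtain h
    where h: "\<forall>n. continuous_on UNIV (h n) \<and> (\<forall>i<n. \<forall>x\<in>\<Union>k\<le>n. S i k. h n x = G i x)" ..
  have "stably_convergent h f"
    unfolding stably_convergent_def
  proof
    fix x
    define i where "i = prod_encode (N x, K (N x) x)"
    have "x \<in> D i" by (simp add: D_def i_def)
    then obtain k where k: "x \<in> S i k" using S(2) by blast
    \<comment> \<open>The bound \<open>Suc i\<close> brings piece \<open>i\<close> into the gluing,
      and the bound \<open>k\<close> puts \<open>x\<close> into its closed part.\<close>
    have "h n x = f x" if "n \<ge> max (Suc i) k" for n
    proof -
      have "x \<in> (\<Union>k\<le>n. S i k)" "i < n" using k that by auto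
      then have "h n x = G i x" using h by blast
      then show ?thesis using GD(1)[OF \<open>x \<in> D i\<close>] by simp
    qed
    then show "\<exists>k. \<forall>n\<ge>k. h n x = f x" by blast
  qed
  moreover have "h n \<in> stable_baire_less 1" for n
    using h by (intro stable_baire_lessI[OF pos]) (simp add: stable_baire_0)
  ultimately show ?thesis by (intro stable_baireI[OF pos])
qed

text \<open>It suffices that each approximant \<open>h n\<close> be piecewise continuous on sets of
  one shifted class from below \<open>\<alpha>\<close>, since \<open>IH\<close> then places it in a
  lower stable class.\<close>

lemma piecewise_imp_stable_baire_step:
  fixes f :: "'a::topological_space \<Rightarrow> 'b::topological_space"
  assumes gt: "1 < \<alpha>"
    and IH: "\<And>\<gamma> g :: 'a \<Rightarrow> 'b. 1 \<le> \<gamma> \<Longrightarrow> \<gamma> < \<alpha> \<Longrightarrow>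
      piecewise_continuous_on_ambiguous (class_shift \<gamma>) g \<Longrightarrow> g \<in> stable_baire \<gamma>"
    and f: "piecewise_continuous_on_ambiguous (class_shift \<alpha>) f"
  shows "f \<in> stable_baire \<alpha>"
proof -
  have pos: "0 < \<alpha>" by (rule countable_ordinal_pos[OF gt])
  then have pos': "0 < class_shift \<alpha>" using le_class_shift[of \<alpha>] by simp
  obtain N F where N: "\<And>n::nat. {x. N x = n} \<in> fun_ambiguous (class_shift \<alpha>)"
    and F: "\<And>n. continuous_on UNIV (F n)" "\<And>x. F (N x) x = f x"
    using f unfolding piecewise_iff by blast
  have "\<forall>i. \<exists>S. (\<forall>k::nat. \<exists>\<gamma><class_shift \<alpha>. S k \<in> fun_mult \<gamma>) \<and> {x. N x = i} = (\<Union>k. S k)"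
    using N unfolding fun_ambiguous_def Int_iff fun_add_pos[OF pos'] by simp
  from choice[OF this] obtain S
    where S: "\<forall>i. (\<forall>k::nat. \<exists>\<gamma><class_shift \<alpha>. S i k \<in> fun_mult \<gamma>) \<and> {x. N x = i} = (\<Union>k. S i k)" ..
  \<comment> \<open>All sets \<open>S i k\<close> are listed as one sequence \<open>P\<close>, and
    \<open>ix m\<close> remembers which map agrees with \<open>f\<close> on
    \<open>P m\<close>.\<close>
  define ix where "ix m = fst (prod_decode m)" for m
  define P where "P m = S (ix m) (snd (prod_decode m))" for m
  have NP: "N x = ix m" if "x \<in> P m" for x m
    using S that unfolding P_def by blast
  have cover: "\<exists>m. x \<in> P m" for x
  proof -
    obtain k where "x \<in> S (N x) k" using S by blast
    then have "x \<in> P (prod_encode (N x, k))" by (simp add: P_def ix_def)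
    then show ?thesis ..
  qed
  have "\<forall>m. \<exists>B. P m = (\<Inter>j::nat. B j) \<and>
      (\<forall>j. \<exists>\<kappa>\<ge>1. \<kappa> < \<alpha> \<and> B j \<in> fun_ambiguous (class_shift \<kappa>))"
  proof
    fix m
    obtain \<gamma> where "\<gamma> < class_shift \<alpha>" "P m \<in> fun_mult \<gamma>" using S unfolding P_def by blast
    then show "\<exists>B. P m = (\<Inter>j::nat. B j) \<and>
        (\<forall>j. \<exists>\<kappa>\<ge>1. \<kappa> < \<alpha> \<and> B j \<in> fun_ambiguous (class_shift \<kappa>))"
      by (rule fun_mult_decompose[OF gt])
  qed
  from choice[OF this] obtain B where B: "\<forall>m. P m = (\<Inter>j::nat. B m j) \<and>
      (\<forall>j. \<exists>\<kappa>\<ge>1. \<kappa> < \<alpha> \<and> B m j \<in> fun_ambiguous (class_shift \<kappa>))" ..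
  then have "\<forall>p. \<exists>\<kappa>. \<kappa> \<ge> 1 \<and> \<kappa> < \<alpha> \<and> B (fst p) (snd p) \<in> fun_ambiguous (class_shift \<kappa>)"
    by blast
  from choice[OF this] obtain \<kappa> where
    \<kappa>: "\<forall>p. \<kappa> p \<ge> 1 \<and> \<kappa> p < \<alpha> \<and> B (fst p) (snd p) \<in> fun_ambiguous (class_shift (\<kappa> p))" ..
  \<comment> \<open>The value \<open>UNIV\<close> beyond \<open>n\<close> ensures that a first index
    exists and is at most \<open>n + 1\<close>. Only finitely many \<open>B m j\<close> enter for
    each \<open>n\<close>.\<close>
  define Q where "Q n m = (if m \<le> n then \<Inter>j\<le>n. B m j else UNIV)" for n m
  define L where "L n x = (LEAST m. x \<in> Q n m)" for n x
  define h where "h n x = F (ix (L n x)) x" for n x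
  have Qcover: "(\<Union>m. Q n m) = UNIV" for n
    using UN_upper[of "Suc n" UNIV "Q n"] by (simp add: Q_def top.extremum_unique)
  have "h n \<in> stable_baire_less \<alpha>" for n
  proof -
    \<comment> \<open>A maximum of finitely many classes below \<open>\<alpha>\<close> is again
      below \<open>\<alpha>\<close>, even when \<open>\<alpha>\<close> is a limit.\<close>
    define \<delta> where "\<delta> = Max (\<kappa> ` ({..n} \<times> {..n}))"
    have fin: "finite (\<kappa> ` ({..n} \<times> {..n}))" by simp
    have "\<delta> \<in> \<kappa> ` ({..n} \<times> {..n})" unfolding \<delta>_def by (rule Max_in[OF fin]) auto
    then have \<delta>: "1 \<le> \<delta>" "\<delta> < \<alpha>" using \<kappa> by auto
    have "B m j \<in> fun_ambiguous (class_shift \<delta>)" if "m \<le> n" "j \<le> n" for m j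
    proof -
      have "\<kappa> (m, j) \<le> \<delta>" unfolding \<delta>_def using that by (intro Max_ge[OF fin] imageI) simp
      moreover have "B m j \<in> fun_ambiguous (class_shift (\<kappa> (m, j)))"
        using \<kappa>[rule_format, of "(m, j)"] by simp
      ultimately show ?thesis using fun_ambiguous_mono[OF _ class_shift_mono] by blast
    qed
    then have "Q n m \<in> fun_ambiguous (class_shift \<delta>)" for m
      unfolding Q_def by (auto intro: fun_ambiguous_INT simp: fun_ambiguous_UNIV)
    then have "{x. L n x = m} \<in> fun_ambiguous (class_shift \<delta>)" for m
      unfolding L_def level_set_Least[OF Qcover] by (intro fun_ambiguous_disjointed)
    then have "piecewise_continuous_on_ambiguous (class_shift \<delta>) (h n)"
      unfolding piecewise_iff
      by (intro exI[of _ "L n"] exI[of _ "\<lambda>m. F (ix m)"]) (simp add: F(1) h_def)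
    then show ?thesis using IH \<delta> by (intro stable_baire_lessI[OF \<delta>(2)])
  qed
  moreover have "stably_convergent h f"
    unfolding stably_convergent_def
  proof
    fix x
    define M where "M = (LEAST m. x \<in> P m)"
    have M: "x \<in> P M" unfolding M_def by (rule LeastI_ex[OF cover])
    have "\<exists>j. x \<notin> B m j" if "m < M" for m
    proof -
      have "x \<notin> P m" using that unfolding M_def by (rule not_less_Least)
      then show ?thesis using B by blast
    qed
    then have "\<forall>m. \<exists>j. m < M \<longrightarrow> x \<notin> B m j" by blast
    from choice[OF this] obtain j where j: "\<forall>m. m < M \<longrightarrow> x \<notin> B m (j m)" ..
    \<comment> \<open>The sum dominates each \<open>j m\<close>, so from \<open>n0\<close> on every
      index below \<open>M\<close> is excluded; the summand \<open>M\<close> ensures that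
      \<open>Q n M\<close> and all earlier sets are genuine intersections.\<close>
    define n0 where "n0 = M + (\<Sum>m<M. j m)"
    have "h n x = f x" if "n \<ge> n0" for n
    proof -
      have "M \<le> n" using that by (simp add: n0_def)
      have "j m \<le> n" if "m < M" for m
      proof -
        have "j m \<le> (\<Sum>m<M. j m)" using that by (intro member_le_sum) auto
        then show ?thesis using \<open>n \<ge> n0\<close> by (simp add: n0_def)
      qed
      then have "x \<notin> Q n m" if "m < M" for m
        using that j \<open>M \<le> n\<close> by (auto simp: Q_def)
      moreover have "x \<in> Q n M"
        using M B by (auto simp: Q_def)
      ultimately have "L n x = M"
        unfolding L_def by (intro Least_equality) (simp, metis not_less)
      then show ?thesis using NP[OF M] F(2)[of x] by (simp add: h_def)
    qed
    then show "\<exists>k. \<forall>n\<ge>k. h n x = f x" by blast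
  qed
  ultimately show ?thesis by (intro stable_baireI[OF pos])
qed

text \<open>Gluing supplies the base \<open>\<alpha> = 1\<close>; every later stage appeals to
  smaller classes that are at least 1.\<close>

lemma piecewise_imp_stable_baire:
  fixes f :: "'a::topological_space \<Rightarrow> 'b::topological_space" and E :: "nat \<Rightarrow> 'b set"
  assumes glue: "finite_gluing E TYPE('a)"
    and E: "(\<Union>n. E n) = UNIV" "\<And>n. functionally_closed (E n)"
    and "1 \<le> \<alpha>" "piecewise_continuous_on_ambiguous (class_shift \<alpha>) f"
  shows "f \<in> stable_baire \<alpha>"
  using assms(4,5)
proof (induction \<alpha> arbitrary: f rule: less_induct)
  case (less \<alpha>)
  show ?case
  proof (cases "\<alpha> = 1")
    case True
    then show ?thesis
      using less.prems(2) by (simp add: piecewise_imp_stable_baire_1[OF glue E])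
  next
    case False
    then have "1 < \<alpha>" using less.prems(1) by simp
    then show ?thesis
      by (rule piecewise_imp_stable_baire_step[OF _ less.IH less.prems(2)])
  qed
qed

section \<open>Assembling the implications\<close>

theorem theorem3p2:
  fixes f :: "'a::topological_space \<Rightarrow> 'b::topological_space"
    and \<alpha> \<beta> :: countable_ordinal
  assumes diagonal: "functionally_closed {(y, y) | y :: 'b. True}"
    and alpha: "1 \<le> \<alpha>"
    and beta: "\<beta> = (if \<alpha> < ord_omega0 then \<alpha> else ord_succ \<alpha>)"
  shows "(f \<in> stable_baire \<alpha> \<longleftrightarrow> stably_exhausted \<alpha> \<beta> f) \<and>
    (stably_exhausted \<alpha> \<beta> f \<longrightarrow> piecewise_continuous_on_ambiguous \<beta> f) \<and>
    (adhesive_for TYPE('b) TYPE('a) \<or>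
       (path_connected (UNIV :: 'b set) \<and> sigma_adhesive_for TYPE('b) TYPE('a)) \<longrightarrow>
     (piecewise_continuous_on_ambiguous \<beta> f \<longrightarrow> stably_exhausted \<alpha> \<beta> f))"
proof -
  have \<beta>: "\<beta> = class_shift \<alpha>" using beta by (simp add: class_shift_def)
  have pos: "0 < \<alpha>" using alpha by (simp add: one_le_countable_ordinal_iff)
  have 12: "stably_exhausted \<alpha> \<beta> f" if "f \<in> stable_baire \<alpha>"
    unfolding \<beta>
    by (rule stable_baire_imp_exhausted[OF diagonal pos stable_baire_imp_piecewise[OF diagonal] that])
  have 21: "f \<in> stable_baire \<alpha>" if "stably_exhausted \<alpha> \<beta> f"
    by (rule exhausted_imp_stable_baire[OF pos that])
  have 23: "piecewise_continuous_on_ambiguous \<beta> f" if "stably_exhausted \<alpha> \<beta> f"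
    unfolding \<beta> by (rule stable_baire_imp_piecewise[OF diagonal 21[OF that]])
  have 32: "stably_exhausted \<alpha> \<beta> f"
    if "adhesive_for TYPE('b) TYPE('a) \<or>
       (path_connected (UNIV :: 'b set) \<and> sigma_adhesive_for TYPE('b) TYPE('a))"
      and pw: "piecewise_continuous_on_ambiguous \<beta> f"
  proof -
    \<comment> \<open>Both (a) and (b) are reduced to a functionally closed cover that admits
      gluing; under (a) every member is the whole space.\<close>
    have "\<exists>E :: nat \<Rightarrow> 'b set. finite_gluing E TYPE('a) \<and> (\<Union>n. E n) = UNIV \<and>
        (\<forall>n. functionally_closed (E n))"
      using that(1)
    proof
      assume "adhesive_for TYPE('b) TYPE('a)"
      then show ?thesis
        by (intro exI[of _ "\<lambda>_. UNIV"]) (simp add: finite_gluing_adhesive functionally_closed_UNIV)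
    next
      assume pc: "path_connected (UNIV :: 'b set) \<and> sigma_adhesive_for TYPE('b) TYPE('a)"
      then obtain E :: "nat \<Rightarrow> 'b set" where E: "(\<Union>n. E n) = UNIV"
          "\<And>n. functionally_closed (E n)" "\<And>n. star_adhesive_for (E n) TYPE('a)"
        unfolding sigma_adhesive_for_def by blast
      then show ?thesis using pc finite_gluing_star_adhesive[of E] by blast
    qed
    then obtain E :: "nat \<Rightarrow> 'b set" where E: "finite_gluing E TYPE('a)" "(\<Union>n. E n) = UNIV"
        "\<And>n. functionally_closed (E n)" by blast
    \<comment> \<open>Condition (3) reaches (2) by way of (1).\<close>
    show ?thesis
      by (rule 12, rule piecewise_imp_stable_baire[OF E alpha pw[unfolded \<beta>]])
  qed
  show ?thesis using 12 21 23 32 by blast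
qed

end
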